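(* Let $H$ be a complex Hilbert space of dimension at least $2$ and let $A\in B(H)$ be nonzero. The following are equivalent. (a) $\rho(AB)\le r(A)r(B)$ for all $B\in B(H)$. (b) $\rho(AB)\le r(A)r(B)$ for all rank one $B\in B(H)$. (c) There is a unique $\mu\in\sigma(A)$ attaining $|\mu|=\rho(A)$, and it satisfies $\|A/\mu-I/2\|\le 1/2$ (in particular $\mu\neq 0$); i.e., $A=\mu(I+L)/2$ for a contraction $L\in B(H)$ with $1\in\sigma(L)$. In case $H$ has finite dimension $n$ (so that $A$ is identified with a matrix in $M_n$), conditions (a)--(c) are also equivalent to the following. (d) There is a unique $\mu\in\sigma(A)$ satisfying $|\mu|=\rho(A)$, and for this $\mu$ the matrix $A$ is unitarily similar to $$\mu\,(I_p\oplus 0_q\oplus C),$$ where $1\le p\le n$, $0\le q\le n-p$, and $C\in M_{n-p-q}$ is invertible with $\|C-I/2\|\le 1/2$ (with $C$ vacuous if $p+q=n$). Here, for invertible $C$, the condition $\|C-I/2\|\le 1/2$ is equivalent to $$W(C^{-1})\subseteq\{z\in\mathbb{C}:\operatorname{Re}(z)\ge 1\}.$$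
   Context: $B(H)$ is the algebra of bounded linear operators on the Hilbert space $H$ with inner product $(x,y)$, and $\|\cdot\|$ is the operator norm. If $\dim H=n<\infty$, $B(H)$ is identified with the set $M_n$ of $n\times n$ complex matrices acting on $\mathbb{C}^n$ with $(x,y)=y^*x$. For $A\in B(H)$: $\sigma(A)$ is the spectrum, $\rho(A)$ the spectral radius, $W(A)=\{(Ax,x):x\in H,\ (x,x)=1\}$ the numerical range, and $r(A)=\sup\{|\mu|:\mu\in W(A)\}$ the numerical radius. A contraction is an operator $L$ with $\|L\|\le 1$. $I_p$ is the $p\times p$ identity matrix and $0_q$ the $q\times q$ zero matrix; $\oplus$ denotes direct (block diagonal) sum. *)

theory Defs
  imports
    "HOL-Analysis.Analysis"
    "Jordan_Normal_Form.Matrix"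
    "Jordan_Normal_Form.Schur_Decomposition"
begin

section \<open>Complex Hilbert spaces\<close>

text \<open>The complex inner product is linear in the first argument, as in \<open>(x,y) = y\<^sup>*x\<close>.
  Its positive definiteness and the norm \<open>sqrt (cinner x x)\<close> come from \<^class>\<open>real_inner\<close>
  through \<open>inner_eq_Re_cinner\<close>.\<close>

class complex_hilbert_space = real_inner + complete_space +
  fixes scaleC :: "complex \<Rightarrow> 'a \<Rightarrow> 'a" (infixr \<open>*\<^sub>C\<close> 75)
    and cinner :: "'a \<Rightarrow> 'a \<Rightarrow> complex"
  assumes scaleC_add_right: "c *\<^sub>C (x + y) = c *\<^sub>C x + c *\<^sub>C y"
    and scaleC_add_left: "(c + d) *\<^sub>C x = c *\<^sub>C x + d *\<^sub>C x"
    and scaleC_scaleC: "c *\<^sub>C d *\<^sub>C x = (c * d) *\<^sub>C x"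
    and scaleC_one: "1 *\<^sub>C x = x"
    and scaleR_scaleC: "r *\<^sub>R x = complex_of_real r *\<^sub>C x"
    and cinner_commute: "cinner x y = cnj (cinner y x)"
    and cinner_add_left: "cinner (x + y) z = cinner x z + cinner y z"
    and cinner_scaleC_left: "cinner (c *\<^sub>C x) y = c * cinner x y"
    and inner_eq_Re_cinner: "inner x y = Re (cinner x y)"

global_interpretation complex_vector: vector_space "scaleC :: complex \<Rightarrow> 'a \<Rightarrow> 'a::complex_hilbert_space"
  defines cdependent = complex_vector.dependent
    and crepresentation = complex_vector.representation
    and csubspace = complex_vector.subspace
    and cspan = complex_vector.span
    and cextend_basis = complex_vector.extend_basis
    and cdim = complex_vector.dim
  by unfold_locales (simp_all add: scaleC_add_right scaleC_add_left scaleC_scaleC scaleC_one)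

instantiation complex :: complex_hilbert_space
begin
definition "scaleC_complex = ((*) :: complex \<Rightarrow> complex \<Rightarrow> complex)"
definition "cinner_complex x y = x * cnj y" for x y :: complex
instance
  by standard (simp_all add: scaleC_complex_def cinner_complex_def algebra_simps
      inner_complex_def scaleR_conv_of_real)
end

instantiation Finite_Cartesian_Product.vec :: (complex_hilbert_space, finite) complex_hilbert_space
begin
definition "scaleC_vec c x = (\<chi> i. c *\<^sub>C Finite_Cartesian_Product.vec_nth x i)"
  for x :: "('a, 'b) Finite_Cartesian_Product.vec"
definition "cinner_vec x y =
    (\<Sum>i\<in>UNIV. cinner (Finite_Cartesian_Product.vec_nth x i) (Finite_Cartesian_Product.vec_nth y i))"
  for x y :: "('a, 'b) Finite_Cartesian_Product.vec"
instance
proof (standard, goal_cases)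
  case (6 x y)
  show ?case
    unfolding cinner_vec_def cnj_sum by (rule sum.cong) (auto intro: cinner_commute)
qed (simp_all add: scaleC_vec_def cinner_vec_def Finite_Cartesian_Product.vec_eq_iff
      scaleC_add_right scaleC_add_left scaleC_scaleC scaleC_one scaleR_scaleC
      cinner_add_left cinner_scaleC_left sum.distrib sum_distrib_left
      inner_vec_def inner_eq_Re_cinner)
end

section \<open>Bounded operators\<close>

definition bounded_clinear :: "('a::complex_hilbert_space \<Rightarrow> 'a) \<Rightarrow> bool" where
  "bounded_clinear A \<longleftrightarrow> bounded_linear A \<and> (\<forall>c x. A (c *\<^sub>C x) = c *\<^sub>C A x)"

definition rank_one :: "('a::complex_hilbert_space \<Rightarrow> 'a) \<Rightarrow> bool" where
  "rank_one B \<longleftrightarrow> cdim (range B) = 1"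

definition op_spectrum :: "('a::complex_hilbert_space \<Rightarrow> 'a) \<Rightarrow> complex set" where
  "op_spectrum A = {l. \<not> (\<exists>R. bounded_clinear R \<and>
      R \<circ> (\<lambda>x. A x - l *\<^sub>C x) = id \<and> (\<lambda>x. A x - l *\<^sub>C x) \<circ> R = id)}"

definition op_spectral_radius :: "('a::complex_hilbert_space \<Rightarrow> 'a) \<Rightarrow> real" where
  "op_spectral_radius A = Sup (cmod ` op_spectrum A)"

definition numerical_range :: "('a::complex_hilbert_space \<Rightarrow> 'a) \<Rightarrow> complex set" where
  "numerical_range A = {cinner (A x) x | x. cinner x x = 1}"

definition numerical_radius :: "('a::complex_hilbert_space \<Rightarrow> 'a) \<Rightarrow> real" where
  "numerical_radius A = Sup (cmod ` numerical_range A)"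

definition contraction :: "('a::complex_hilbert_space \<Rightarrow> 'a) \<Rightarrow> bool" where
  "contraction L \<longleftrightarrow> bounded_clinear L \<and> onorm L \<le> 1"

definition unique_peripheral :: "('a::complex_hilbert_space \<Rightarrow> 'a) \<Rightarrow> complex \<Rightarrow> bool" where
  "unique_peripheral A \<mu> \<longleftrightarrow> \<mu> \<in> op_spectrum A \<and> cmod \<mu> = op_spectral_radius A \<and>
     (\<forall>\<nu>\<in>op_spectrum A. cmod \<nu> = op_spectral_radius A \<longrightarrow> \<nu> = \<mu>)"

section \<open>Orthonormal bases and the identification of operators with matrices\<close>

definition orthonormal :: "nat \<Rightarrow> (nat \<Rightarrow> 'a::complex_hilbert_space) \<Rightarrow> bool" where
  "orthonormal n e \<longleftrightarrow> (\<forall>i<n. \<forall>j<n. cinner (e i) (e j) = (if i = j then 1 else 0))"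

definition orthonormal_basis :: "nat \<Rightarrow> (nat \<Rightarrow> 'a::complex_hilbert_space) \<Rightarrow> bool" where
  "orthonormal_basis n e \<longleftrightarrow> orthonormal n e \<and> cspan (e ` {..<n}) = UNIV"

definition op_mat :: "nat \<Rightarrow> (nat \<Rightarrow> 'a::complex_hilbert_space) \<Rightarrow> ('a \<Rightarrow> 'a) \<Rightarrow> complex mat" where
  "op_mat n e A = Matrix.mat n n (\<lambda>(i, j). cinner (A (e j)) (e i))"

lemma cinner_zero_left [simp]: "cinner 0 y = 0"
  by (metis add_cancel_right_left cinner_add_left)

lemma cinner_sum_left: "cinner (sum f S) y = (\<Sum>i\<in>S. cinner (f i) y)"
  by (induction S rule: infinite_finite_induct) (simp_all add: cinner_add_left)

lemma cinner_diff_left: "cinner (x - z) y = cinner x y - cinner z y"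
  by (metis add_diff_cancel cinner_add_left diff_add_cancel)

lemma cinner_scaleC_right: "cinner x (c *\<^sub>C y) = cnj c * cinner x y"
  by (metis cinner_commute cinner_scaleC_left complex_cnj_mult)

lemma cinner_self: "cinner x x = complex_of_real ((norm x)\<^sup>2)"
proof -
  have "Im (cinner x x) = 0"
    using cinner_commute[of x x] by (metis complex_cnj_cancel_iff complex_cnj_complex_of_real
        complex_is_Real_iff Reals_cnj_iff)
  moreover have "Re (cinner x x) = (norm x)\<^sup>2"
    by (simp add: power2_norm_eq_inner inner_eq_Re_cinner)
  ultimately show ?thesis by (simp add: complex_eq_iff)
qed

lemma orthonormal_extend:
  fixes B :: "'a::complex_hilbert_space set"
  assumes "finite B"
  shows "\<exists>n e. orthonormal n e \<and> cspan (e ` {..<n}) = cspan B"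
  using assms
proof (induction B)
  case empty
  show ?case by (rule exI[of _ 0]) (simp add: orthonormal_def)
next
  case (insert b B)
  then obtain n e where e: "orthonormal n e" "cspan (e ` {..<n}) = cspan B" by blast
  define s where "s = (\<Sum>i<n. cinner b (e i) *\<^sub>C e i)"
  define r where "r = b - s"
  have s: "s \<in> cspan B"
    unfolding s_def e(2)[symmetric]
    by (intro complex_vector.span_sum complex_vector.span_scale complex_vector.span_base) auto
  have perp: "cinner r (e j) = 0" if "j < n" for j
  proof -
    have "cinner s (e j) = (\<Sum>i<n. cinner b (e i) * (if i = j then 1 else 0))"
      unfolding s_def cinner_sum_left cinner_scaleC_left
      using e(1) that by (intro sum.cong) (auto simp: orthonormal_def)
    also have "\<dots> = cinner b (e j)" using that by (simp add: mult_delta_right sum.delta')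
    finally show ?thesis by (simp add: r_def cinner_diff_left)
  qed
  show ?case
  proof (cases "r = 0")
    case True
    then have "b \<in> cspan B" using s by (simp add: r_def)
    then have "cspan (insert b B) = cspan B" by (rule complex_vector.span_redundant)
    then show ?thesis using e by metis
  next
    case False
    define u where "u = complex_of_real (inverse (norm r)) *\<^sub>C r"
    define e' where "e' = e(n := u)"
    have un: "cinner u u = 1"
      using False by (simp add: u_def cinner_scaleC_left cinner_scaleC_right cinner_self[of r]
          power2_eq_square field_simps)
    have up: "cinner u (e j) = 0" "cinner (e j) u = 0" if "j < n" for j
      using perp[OF that] cinner_commute[of "e j" u]
      by (simp_all add: u_def cinner_scaleC_left cinner_scaleC_right cinner_commute[of "e j" r])
    have "orthonormal (Suc n) e'"
      using e(1) un up by (auto simp: orthonormal_def e'_def less_Suc_eq)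
    moreover have "cspan (e' ` {..<Suc n}) = cspan (insert b B)"
    proof -
      have im: "e' ` {..<Suc n} = insert u (e ` {..<n})"
        by (auto simp: e'_def lessThan_Suc)
      have b: "b = complex_of_real (norm r) *\<^sub>C u + s"
        using False by (simp add: u_def r_def scaleC_scaleC)
      have sB: "s \<in> cspan (insert b B)" using s complex_vector.span_mono[of B "insert b B"] by auto
      have u: "u \<in> cspan (insert b B)"
        unfolding u_def r_def
        by (intro complex_vector.span_scale complex_vector.span_diff sB complex_vector.span_base) simp
      have su: "cspan B \<subseteq> cspan (insert u (e ` {..<n}))"
        unfolding e(2)[symmetric] by (rule complex_vector.span_mono) auto
      have bu: "b \<in> cspan (insert u (e ` {..<n}))"
        by (subst b, intro complex_vector.span_add complex_vector.span_scale subsetD[OF su s]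
            complex_vector.span_base) simp
      have "insert u (e ` {..<n}) \<subseteq> cspan (insert b B)"
      proof -
        have "e ` {..<n} \<subseteq> cspan B"
          unfolding e(2)[symmetric] by (rule complex_vector.span_superset)
        also have "\<dots> \<subseteq> cspan (insert b B)" by (rule complex_vector.span_mono) auto
        finally show ?thesis using u by simp
      qed
      moreover have "insert b B \<subseteq> cspan (insert u (e ` {..<n}))"
        using bu su complex_vector.span_superset[of B] by blast
      ultimately show ?thesis unfolding im complex_vector.span_eq by blast
    qed
    ultimately show ?thesis by blast
  qed
qed

lemma orthonormal_basis_dim:
  fixes e :: "nat \<Rightarrow> 'a::complex_hilbert_space"
  assumes "orthonormal_basis n e"
  shows "cdim (UNIV :: 'a set) = n"
proof -
  have on: "orthonormal n e" and sp: "cspan (e ` {..<n}) = UNIV"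
    using assms by (auto simp: orthonormal_basis_def)
  have inj: "inj_on e {..<n}"
    using on by (intro inj_onI) (metis lessThan_iff orthonormal_def zero_neq_one)
  have "\<not> cdependent (e ` {..<n})"
  proof (rule complex_vector.independent_if_scalars_zero)
    fix f x
    assume z: "(\<Sum>x\<in>e ` {..<n}. f x *\<^sub>C x) = 0" and x: "x \<in> e ` {..<n}"
    then obtain j where j: "j < n" "x = e j" by auto
    have "0 = cinner (\<Sum>i<n. f (e i) *\<^sub>C e i) (e j)"
      using z by (simp add: sum.reindex[OF inj])
    also have "\<dots> = (\<Sum>i<n. f (e i) * (if i = j then 1 else 0))"
      unfolding cinner_sum_left cinner_scaleC_left
      using on j by (intro sum.cong) (auto simp: orthonormal_def)
    also have "\<dots> = f x" using j by (simp add: mult_delta_right sum.delta')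
    finally show "f x = 0" by simp
  qed simp
  then show ?thesis
    using complex_vector.dim_eq_card[of "e ` {..<n}" UNIV] sp card_image[OF inj]
    by (simp add: complex_vector.span_UNIV)
qed

lemma orthonormal_basis_exists:
  assumes "finite B" and "cspan B = (UNIV :: 'a::complex_hilbert_space set)"
  shows "\<exists>e :: nat \<Rightarrow> 'a. orthonormal_basis (cdim (UNIV :: 'a set)) e"
proof -
  obtain n and e :: "nat \<Rightarrow> 'a" where "orthonormal_basis n e"
    using orthonormal_extend[OF assms(1)] assms(2) unfolding orthonormal_basis_def by metis
  then show ?thesis using orthonormal_basis_dim by metis
qed

section \<open>Complex matrices\<close>

definition euclidean_norm :: "complex Matrix.vec \<Rightarrow> real" where
  "euclidean_norm v = sqrt (Re (v \<bullet>c v))"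

definition mat_opnorm :: "complex mat \<Rightarrow> real" where
  "mat_opnorm M = Sup {euclidean_norm (M *\<^sub>v v) | v. v \<in> carrier_vec (dim_col M) \<and> euclidean_norm v \<le> 1}"

definition mat_numerical_range :: "complex mat \<Rightarrow> complex set" where
  "mat_numerical_range M = {(M *\<^sub>v v) \<bullet>c v | v. v \<in> carrier_vec (dim_col M) \<and> v \<bullet>c v = 1}"

text \<open>\<open>similar_mat_wit M N U (mat_adjoint U)\<close> contains both \<open>U U\<^sup>* = I\<close> and \<open>U\<^sup>* U = I\<close>.\<close>

definition unitarily_similar :: "complex mat \<Rightarrow> complex mat \<Rightarrow> bool" where
  "unitarily_similar M N \<longleftrightarrow> (\<exists>U. similar_mat_wit M N U (mat_adjoint U))"

end

theory Submission
  imports Defs "HOL-Complex_Analysis.Cauchy_Integral_Formula"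
begin

text \<open>Write \<open>r\<close> for the numerical radius.
  If \<open>A = \<mu>(I + L)/2\<close> with a contraction \<open>L\<close> and \<open>\<bar>l\<bar> > \<bar>\<mu>\<bar> r(B)\<close>, then \<open>S = (\<mu>/2) B - l\<close> is invertible and
  \<open>\<parallel>S x\<parallel>\<^sup>2 - \<parallel>(\<mu>/2) B x\<parallel>\<^sup>2 \<ge> \<delta> \<parallel>x\<parallel>\<^sup>2\<close>, so \<open>A B - l = S + (\<mu>/2) L B\<close> is invertible by a Neumann series; moreover
  \<open>\<bar>\<mu>\<bar> \<le> r(A)\<close> because \<open>\<mu>\<close> lies in the spectrum of \<open>A\<close>.

  Conversely, testing with \<open>B = (\<cdot>, u) v\<close> and Buzano's inequality gives
  \<open>2 \<bar>(A v, u)\<bar> \<le> r(A) (\<parallel>u\<parallel> \<parallel>v\<parallel> + \<bar>(v, u)\<bar>)\<close>. Choose \<open>\<mu>\<close> in the closure of the numerical range with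
  \<open>\<bar>\<mu>\<bar> = r(A)\<close> and set \<open>K = A/\<mu> - I\<close>. At a unit vector \<open>v\<close> with \<open>(K v, v)\<close> close to \<open>0\<close>, first order perturbation
  in \<open>u\<close> or \<open>v\<close> shows that \<open>K v\<close> is small and \<open>v\<close> is nearly orthogonal to the range of \<open>K\<close>. The second order
  expansion at \<open>(v + \<epsilon> x, v + \<epsilon> y)\<close> then yields \<open>4 Re (K x, y) \<le> \<parallel>x - y\<parallel>\<^sup>2\<close>, that is, \<open>\<parallel>2 K + I\<parallel> \<le> 1\<close>.

  In finite dimension the eigenspaces of \<open>A\<close> for \<open>\<mu>\<close> and \<open>0\<close> are those of \<open>L\<close> for \<open>1\<close> and \<open>-1\<close>; they reduce
  \<open>A\<close> since unimodular eigenvectors of a contraction are eigenvectors of its adjoint.\<close>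

section \<open>Invertible operators\<close>

lemma norm_scaleC: "norm (c *\<^sub>C x) = cmod c * norm x"
proof -
  have "complex_of_real ((norm (c *\<^sub>C x))\<^sup>2) = complex_of_real ((cmod c * norm x)\<^sup>2)"
    unfolding cinner_self[symmetric] cinner_scaleC_left cinner_scaleC_right
    by (simp add: cinner_self power_mult_distrib mult.assoc[symmetric] complex_norm_square[unfolded of_real_power])
  then show ?thesis
    by (simp only: of_real_eq_iff) (simp add: power2_eq_iff_nonneg)
qed

lemma cinner_add_right: "cinner x (y + z) = cinner x y + cinner x z"
  by (metis cinner_add_left cinner_commute complex_cnj_add)

lemma cinner_zero_right [simp]: "cinner x 0 = 0"
  by (metis cinner_commute cinner_zero_left complex_cnj_zero)

lemma cinner_sum_right: "cinner y (sum f S) = (\<Sum>i\<in>S. cinner y (f i))"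
  by (induction S rule: infinite_finite_induct) (simp_all add: cinner_add_right)

lemma Re_cinner_self: "Re (cinner x x) = (norm x)\<^sup>2"
  by (simp add: cinner_self)

lemma cmod_cinner_commute: "cmod (cinner x y) = cmod (cinner y x)"
  by (metis cinner_commute complex_mod_cnj)

lemma cinner_eq_zero_commute: "cinner x y = 0 \<longleftrightarrow> cinner y x = 0"
  by (metis cinner_commute complex_cnj_zero)

text \<open>Rotation by a unimodular factor turns estimates of real parts into estimates of moduli;
  it is applied wherever only the real part of an inner product can be bounded directly.\<close>

lemma phase_exists:
  obtains w where "cmod w = 1" "w * z = complex_of_real (cmod z)"
proof (cases "z = 0")
  case True
  then show ?thesis using that[of 1] by simp
next
  case False
  have "cnj z / complex_of_real (cmod z) * z = complex_of_real (cmod z)"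
    using False by (simp add: complex_norm_square[symmetric] mult.commute power2_eq_square)
  then show ?thesis using that[of "cnj z / complex_of_real (cmod z)"] False
    by (simp add: norm_divide)
qed

text \<open>Real Cauchy-Schwarz controls only the real part of the complex product, so
  \<open>x\<close> is first rotated to make the product real and nonnegative.\<close>

lemma cmod_cinner_le: "cmod (cinner x y) \<le> norm x * norm y"
proof -
  obtain w where w: "cmod w = 1" "w * cinner x y = complex_of_real (cmod (cinner x y))"
    by (rule phase_exists)
  have "cmod (cinner x y) = inner (w *\<^sub>C x) y"
    by (simp add: inner_eq_Re_cinner cinner_scaleC_left w)
  also have "\<dots> \<le> norm (w *\<^sub>C x) * norm y" by (rule norm_cauchy_schwarz)
  finally show ?thesis by (simp add: norm_scaleC w)
qed

lemma norm_add_sq: "(norm (x + y))\<^sup>2 = (norm x)\<^sup>2 + 2 * Re (cinner x y) + (norm y)\<^sup>2"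
  by (simp add: power2_norm_eq_inner inner_add_left inner_add_right inner_commute
      inner_eq_Re_cinner[symmetric])

lemma norm_diff_sq: "(norm (x - y))\<^sup>2 = (norm x)\<^sup>2 - 2 * Re (cinner x y) + (norm y)\<^sup>2"
  by (simp add: power2_norm_eq_inner inner_diff_left inner_diff_right inner_commute
      inner_eq_Re_cinner[symmetric])

lemma scaleC_diff_right: "c *\<^sub>C (x - y) = c *\<^sub>C x - c *\<^sub>C y"
  by (rule complex_vector.scale_right_diff_distrib)

lemma scaleC_diff_left: "(c - d) *\<^sub>C x = c *\<^sub>C x - d *\<^sub>C x"
  by (rule complex_vector.scale_left_diff_distrib)

lemmas scaleC_zero [simp] = complex_vector.scale_zero_left complex_vector.scale_zero_right

declare scaleC_one [simp]

section \<open>Bounded complex-linear operators\<close>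

lemma bounded_clinearI:
  assumes "\<And>x y. A (x + y) = A x + A y" "\<And>c x. A (c *\<^sub>C x) = c *\<^sub>C A x"
    and "\<And>x. norm (A x) \<le> K * norm x"
  shows "bounded_clinear A"
  unfolding bounded_clinear_def
  using assms by (auto intro!: bounded_linear_intro[where K = K] simp: scaleR_scaleC mult.commute)

lemma bounded_clinearD:
  assumes "bounded_clinear A"
  shows "bounded_linear A" "A (x + y) = A x + A y" "A (x - y) = A x - A y"
    "A (c *\<^sub>C x) = c *\<^sub>C A x" "A 0 = 0" "A (sum f S) = (\<Sum>i\<in>S. A (f i))"
proof -
  show b: "bounded_linear A" using assms by (simp add: bounded_clinear_def)
  interpret bounded_linear A by (rule b)
  show "A (x + y) = A x + A y" "A (x - y) = A x - A y" "A 0 = 0" "A (sum f S) = (\<Sum>i\<in>S. A (f i))"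
    by (rule add diff zero sum)+
  show "A (c *\<^sub>C x) = c *\<^sub>C A x" using assms by (simp add: bounded_clinear_def)
qed

lemma bounded_clinear_boundE:
  assumes "bounded_clinear A"
  obtains K where "K > 0" "\<And>x. norm (A x) \<le> K * norm x"
  using bounded_linear.pos_bounded[OF bounded_clinearD(1)[OF assms]] by (metis mult.commute)

lemma bounded_clinear_comp:
  assumes "bounded_clinear A" "bounded_clinear B"
  shows "bounded_clinear (\<lambda>x. A (B x))"
  using assms bounded_linear_compose[of A B] by (simp add: bounded_clinear_def)

lemma bounded_clinear_add:
  assumes "bounded_clinear A" "bounded_clinear B"
  shows "bounded_clinear (\<lambda>x. A x + B x)"
  using assms bounded_linear_add[of A B] by (simp add: bounded_clinear_def scaleC_add_right)

lemma bounded_clinear_diff: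
  assumes "bounded_clinear A" "bounded_clinear B"
  shows "bounded_clinear (\<lambda>x. A x - B x)"
  using assms bounded_linear_sub[of A B] by (simp add: bounded_clinear_def scaleC_diff_right)

lemma bounded_clinear_scaleC: "bounded_clinear (\<lambda>x. c *\<^sub>C x)"
  by (rule bounded_clinearI[where K = "cmod c"])
    (simp_all add: scaleC_add_right scaleC_scaleC norm_scaleC mult.commute)

lemma bounded_clinear_ident: "bounded_clinear (\<lambda>x. x)"
  using bounded_clinear_scaleC[of 1] by simp

lemmas bounded_clinear_scaleC_comp = bounded_clinear_comp[OF bounded_clinear_scaleC]

lemma bounded_clinear_minus_scaleC:
  "bounded_clinear A \<Longrightarrow> bounded_clinear (\<lambda>x. A x - l *\<^sub>C x)"
  by (rule bounded_clinear_diff[OF _ bounded_clinear_scaleC])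

lemma bounded_clinear_onorm: "bounded_clinear A \<Longrightarrow> norm (A x) \<le> onorm A * norm x"
  by (rule onorm[OF bounded_clinearD(1)])

section \<open>Invertibility criteria\<close>

definition op_invertible :: "('a::complex_hilbert_space \<Rightarrow> 'a) \<Rightarrow> bool" where
  "op_invertible T \<longleftrightarrow> (\<exists>R. bounded_clinear R \<and> R \<circ> T = id \<and> T \<circ> R = id)"

lemma op_spectrum_iff: "l \<in> op_spectrum A \<longleftrightarrow> \<not> op_invertible (\<lambda>x. A x - l *\<^sub>C x)"
  by (simp add: op_spectrum_def op_invertible_def)

lemma op_invertibleE:
  assumes "op_invertible T"
  obtains R where "bounded_clinear R" "\<And>x. R (T x) = x" "\<And>x. T (R x) = x"
  using assms by (auto simp: op_invertible_def fun_eq_iff)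

lemma op_invertibleI:
  assumes "bounded_clinear R" "\<And>x. R (T x) = x" "\<And>x. T (R x) = x"
  shows "op_invertible T"
  using assms by (auto simp: op_invertible_def fun_eq_iff)

lemma op_invertible_bounded_below:
  assumes "op_invertible T"
  obtains c where "c > 0" "\<And>x. c * norm x \<le> norm (T x)"
proof -
  obtain R where R: "bounded_clinear R" "\<And>x. R (T x) = x" using op_invertibleE[OF assms] by metis
  obtain K where K: "K > 0" "\<And>x. norm (R x) \<le> K * norm x"
    using bounded_clinear_boundE[OF R(1)] by metis
  have "inverse K * norm x \<le> norm (T x)" for x
    using K(2)[of "T x"] K(1) by (simp add: R(2) field_simps)
  then show ?thesis using that[of "inverse K"] K(1) by simp
qed

lemma op_invertible_comp:
  assumes "op_invertible S" "op_invertible T"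
  shows "op_invertible (\<lambda>x. S (T x))"
proof -
  obtain R where R: "bounded_clinear R" "\<And>x. R (S x) = x" "\<And>x. S (R x) = x"
    using op_invertibleE[OF assms(1)] by metis
  obtain Q where Q: "bounded_clinear Q" "\<And>x. Q (T x) = x" "\<And>x. T (Q x) = x"
    using op_invertibleE[OF assms(2)] by metis
  show ?thesis
    by (rule op_invertibleI[where R = "\<lambda>x. Q (R x)"])
      (simp_all add: R Q bounded_clinear_comp)
qed

lemma op_invertible_scaleC_comp:
  assumes "c \<noteq> 0"
  shows "op_invertible (\<lambda>x. c *\<^sub>C T x) \<longleftrightarrow> op_invertible T"
proof -
  have s: "op_invertible (\<lambda>x. c *\<^sub>C x)" if "c \<noteq> 0" for c
    using that by (intro op_invertibleI[where R = "\<lambda>x. inverse c *\<^sub>C x"])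
      (simp_all add: bounded_clinear_scaleC scaleC_scaleC)
  have "T = (\<lambda>x. inverse c *\<^sub>C c *\<^sub>C T x)"
    using assms by (simp add: scaleC_scaleC)
  then show ?thesis
    using op_invertible_comp[OF s] assms nonzero_imp_inverse_nonzero by metis
qed

text \<open>The lower bound does two jobs: it gives injectivity, and it bounds the set-theoretic
  inverse by \<open>inverse c\<close>.\<close>

lemma op_invertible_surj:
  assumes T: "bounded_clinear T" and c: "c > 0" "\<And>x. c * norm x \<le> norm (T x)" and "surj T"
  shows "op_invertible T"
proof -
  note l = bounded_clinearD[OF T]
  have "inj T"
  proof (rule injI)
    fix x y assume "T x = T y"
    then have "T (x - y) = 0" by (simp add: l)
    then show "x = y" using c(2)[of "x - y"] c(1) by (simp add: mult_le_0_iff)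
  qed
  then have R: "inv_into UNIV T (T x) = x" "T (inv_into UNIV T x) = x" for x
    using \<open>surj T\<close> by (simp_all add: surj_f_inv_f)
  have "bounded_clinear (inv_into UNIV T)"
  proof (rule bounded_clinearI)
    show "inv_into UNIV T (x + y) = inv_into UNIV T x + inv_into UNIV T y" for x y by (metis R l(2))
    show "inv_into UNIV T (a *\<^sub>C x) = a *\<^sub>C inv_into UNIV T x" for a x by (metis R l(4))
    show "norm (inv_into UNIV T x) \<le> inverse c * norm x" for x
      using c(2)[of "inv_into UNIV T x"] c(1) by (simp add: R field_simps)
  qed
  then show ?thesis using R by (rule op_invertibleI)
qed

text \<open>The reverse triangle inequality bounds I - K below by 1 - q. Solving x - K x = y amounts
  to finding a fixed point of x \<mapsto> y + K x, which Banach's theorem provides.\<close>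

lemma neumann_invertible:
  assumes K: "bounded_clinear K" and q: "q < 1" "\<And>x. norm (K x) \<le> q * norm x"
  shows "op_invertible (\<lambda>x. x - K x)"
proof (rule op_invertible_surj)
  note l = bounded_clinearD[OF K]
  show "bounded_clinear (\<lambda>x. x - K x)"
    by (intro bounded_clinear_diff bounded_clinear_ident K)
  show "1 - q > 0" using q by simp
  show "(1 - q) * norm x \<le> norm (x - K x)" for x
    using norm_triangle_ineq2[of x "K x"] q(2)[of x] by (simp add: algebra_simps)
  have "\<exists>x. x - K x = y" for y
  proof -
    have "\<exists>!x. y + K x = x"
    \<comment> \<open>The sign of \<open>q\<close> is not fixed by the assumptions, whereas a
      Lipschitz constant has to be nonnegative.\<close>
    proof (rule banach_fix_type[where c = "max q 0"])
      show "\<forall>x. \<forall>z. dist (y + K x) (y + K z) \<le> max q 0 * dist x z"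
      proof (intro allI)
        fix x z
        have "dist (y + K x) (y + K z) = norm (K (x - z))" by (simp add: dist_norm l)
        also have "\<dots> \<le> q * norm (x - z)" by (rule q)
        also have "\<dots> \<le> max q 0 * norm (x - z)" by (intro mult_right_mono) auto
        finally show "dist (y + K x) (y + K z) \<le> max q 0 * dist x z" by (simp add: dist_norm)
      qed
    qed (use q in auto)
    then obtain x where "y + K x = x" by blast
    then show "\<exists>x. x - K x = y" by (metis add_diff_cancel_right')
  qed
  then show "surj (\<lambda>x. x - K x)" by (metis surjI)
qed

text \<open>Lax--Milgram without the Riesz representation theorem: \<open>I - t w S\<close> is a strict contraction for small \<open>t > 0\<close>.\<close>

lemma coercive_invertible:
  assumes S: "bounded_clinear S" and c: "c > 0" "\<And>x. c * (norm x)\<^sup>2 \<le> Re (w * cinner (S x) x)"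
  shows "op_invertible S"
proof (cases "\<exists>x::'a. x \<noteq> 0")
  case False
  then have "op_invertible S"
    by (intro op_invertibleI[where R = "\<lambda>x. x"] bounded_clinear_ident) metis+
  then show ?thesis .
next
  case True
  then obtain x0 :: 'a where x0: "x0 \<noteq> 0" by blast
  have w0: "w \<noteq> 0"
  proof
    assume "w = 0"
    then show False using c(2)[of x0] c(1) x0 by (simp add: mult_le_0_iff)
  qed
  define V where "V x = w *\<^sub>C S x" for x
  have V: "bounded_clinear V" unfolding V_def by (rule bounded_clinear_scaleC_comp[OF S])
  have cV: "c * (norm x)\<^sup>2 \<le> Re (cinner (V x) x)" for x
    using c(2)[of x] by (simp add: V_def cinner_scaleC_left)
  obtain M where M: "M > 0" "\<And>x. norm (V x) \<le> M * norm x" using bounded_clinear_boundE[OF V] by metis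
  \<comment> \<open>This t minimises 1 - 2 t c + t^2 M^2, and the minimum equals 1 - t c.\<close>
  define t where "t = c / M\<^sup>2"
  have t: "t > 0" using c M by (simp add: t_def)
  \<comment> \<open>The maximum with 0 makes \<open>q\<close> nonnegative without a comparison of
    \<open>c\<close> with \<open>M\<close>.\<close>
  define q where "q = sqrt (max 0 (1 - t * c))"
  have q1: "q < 1" using t c(1) by (auto simp: q_def max_def)
  have q2: "norm (x - of_real t *\<^sub>C V x) \<le> q * norm x" for x
  proof -
    have n: "(norm (V x))\<^sup>2 \<le> M\<^sup>2 * (norm x)\<^sup>2"
      using power_mono[OF M(2)[of x], of 2] by (simp add: power_mult_distrib)
    have "(norm (x - of_real t *\<^sub>C V x))\<^sup>2
        = (norm x)\<^sup>2 - 2 * t * Re (cinner (V x) x) + t\<^sup>2 * (norm (V x))\<^sup>2"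
    proof -
      have "Re (cinner x (V x)) = Re (cinner (V x) x)" by (metis cinner_commute complex_cnj(1) cnj.sel(1))
      then show ?thesis
        by (simp add: norm_diff_sq cinner_scaleC_right norm_scaleC power_mult_distrib)
    qed
    also have "\<dots> \<le> (norm x)\<^sup>2 - 2 * t * (c * (norm x)\<^sup>2) + t\<^sup>2 * (M\<^sup>2 * (norm x)\<^sup>2)"
      using t by (intro add_mono diff_mono mult_left_mono cV n) auto
    also have "\<dots> = (1 - t * c) * (norm x)\<^sup>2"
      using M(1) by (simp add: t_def field_simps power2_eq_square)
    also have "\<dots> \<le> max 0 (1 - t * c) * (norm x)\<^sup>2" by (intro mult_right_mono) auto
    also have "\<dots> = (q * norm x)\<^sup>2" by (simp add: q_def power_mult_distrib)
    finally show ?thesis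
      by (rule power2_le_imp_le) (simp add: q_def)
  qed
  have "op_invertible (\<lambda>x. x - (x - of_real t *\<^sub>C V x))"
    by (rule neumann_invertible[OF _ q1 q2])
      (intro bounded_clinear_diff bounded_clinear_ident bounded_clinear_scaleC_comp V)
  then have "op_invertible (\<lambda>x. (of_real t * w) *\<^sub>C S x)" by (simp add: V_def scaleC_scaleC)
  then show ?thesis using op_invertible_scaleC_comp[of "of_real t * w" S] t w0 by simp
qed

section \<open>Spectrum and numerical radius\<close>

text \<open>Supplies the continuity of the inner product used when resolvents are
  differentiated.\<close>

lemma bounded_bilinear_cinner: "bounded_bilinear cinner"
proof
  show "cinner (r *\<^sub>R a) b = r *\<^sub>R cinner a b" for r and a b :: 'a
    by (simp add: scaleR_scaleC[where 'a = 'a] cinner_scaleC_left scaleR_conv_of_real)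
  show "cinner a (r *\<^sub>R b) = r *\<^sub>R cinner a b" for r and a b :: 'a
    by (simp add: scaleR_scaleC[where 'a = 'a] cinner_scaleC_right scaleR_conv_of_real)
  show "\<exists>K. \<forall>a b::'a. norm (cinner a b) \<le> norm a * norm b * K"
    using cmod_cinner_le by (intro exI[of _ 1]) auto
qed (simp_all add: cinner_add_left cinner_add_right)

section \<open>Quadratic form bounds from the numerical radius\<close>

lemma numerical_range_eq: "numerical_range A = {cinner (A x) x | x. norm x = 1}"
proof -
  have "cinner x x = 1 \<longleftrightarrow> norm x = 1" for x :: 'a
    by (simp only: cinner_self of_real_eq_1_iff) (use norm_ge_zero[of x] in \<open>simp add: power2_eq_1_iff, linarith\<close>)
  then show ?thesis by (simp add: numerical_range_def)
qed

lemma numerical_range_bdd_above: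
  assumes "bounded_clinear A"
  shows "bdd_above (cmod ` numerical_range A)"
proof (rule bdd_aboveI2)
  fix z assume "z \<in> numerical_range A"
  then obtain x where x: "z = cinner (A x) x" "norm x = 1" by (auto simp: numerical_range_eq)
  then show "cmod z \<le> onorm A"
    using cmod_cinner_le[of "A x" x] bounded_clinear_onorm[OF assms, of x] by simp
qed

lemma numerical_radius_bound:
  assumes "bounded_clinear A"
  shows "cmod (cinner (A x) x) \<le> numerical_radius A * (norm x)\<^sup>2"
proof (cases "x = 0")
  case False
  define u where "u = complex_of_real (inverse (norm x)) *\<^sub>C x"
  have u: "norm u = 1" using False by (simp add: u_def norm_scaleC norm_inverse)
  have "cmod (cinner (A u) u) \<le> numerical_radius A"
    unfolding numerical_radius_def
    by (rule cSUP_upper[OF _ numerical_range_bdd_above[OF assms]])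
      (use u in \<open>auto simp: numerical_range_eq\<close>)
  moreover have "cinner (A u) u = complex_of_real (inverse ((norm x)\<^sup>2)) * cinner (A x) x"
    by (simp add: u_def bounded_clinearD[OF assms] cinner_scaleC_left cinner_scaleC_right
        power2_eq_square)
  ultimately have "inverse ((norm x)\<^sup>2) * cmod (cinner (A x) x) \<le> numerical_radius A"
    by (simp add: norm_mult norm_inverse norm_power)
  then show ?thesis using False by (simp add: field_simps)
qed (simp add: bounded_clinearD[OF assms])

lemma unit_vector_exists:
  fixes x :: "'a::complex_hilbert_space"
  assumes "x \<noteq> 0"
  obtains u :: 'a where "norm u = 1"
  using that[of "x /\<^sub>R norm x"] assms by simp

text \<open>A nonzero vector has to exist: on the zero space the defining supremum runs over the
  empty set.\<close>

lemma numerical_radius_nonneg: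
  fixes A :: "'a::complex_hilbert_space \<Rightarrow> 'a"
  assumes "bounded_clinear A" "x \<noteq> (0::'a)"
  shows "0 \<le> numerical_radius A"
proof -
  obtain u :: 'a where u: "norm u = 1" using unit_vector_exists[OF assms(2)] .
  show ?thesis using numerical_radius_bound[OF assms(1), of u] u order_trans[OF norm_ge_zero] by fastforce
qed

lemma numerical_radius_leI:
  fixes A :: "'a::complex_hilbert_space \<Rightarrow> 'a"
  assumes "x \<noteq> (0::'a)"
    and "\<And>x. norm x = 1 \<Longrightarrow> cmod (cinner (A x) x) \<le> k"
  shows "numerical_radius A \<le> k"
proof -
  obtain u :: 'a where "norm u = 1" using unit_vector_exists[OF assms(1)] .
  then have "cinner (A u) u \<in> numerical_range A" by (auto simp: numerical_range_eq)
  then have "numerical_range A \<noteq> {}" by blast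
  then show ?thesis
    unfolding numerical_radius_def using assms(2)
    by (intro cSUP_least) (auto simp: numerical_range_eq)
qed

text \<open>If |l| > r, multiplying the form of A - l by -conj l gives real part at least |l| (|l| -
  r) ||x||^2, so A - l is coercive. The bound r is kept abstract so that the lemma also covers norm
  bounds and scaled operators.\<close>

lemma spectrum_le_quadratic_bound:
  assumes A: "bounded_clinear A" and l: "l \<in> op_spectrum A"
    and r: "\<And>x. cmod (cinner (A x) x) \<le> r * (norm x)\<^sup>2" "0 \<le> r"
  shows "cmod l \<le> r"
proof (rule ccontr)
  assume "\<not> cmod l \<le> r"
  then have gt: "cmod l > r" by simp
  have "op_invertible (\<lambda>x. A x - l *\<^sub>C x)"
  proof (rule coercive_invertible[where w = "- cnj l"])
    show "bounded_clinear (\<lambda>x. A x - l *\<^sub>C x)" by (rule bounded_clinear_minus_scaleC[OF A])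
    show "cmod l * (cmod l - r) > 0" using gt r(2) by (intro mult_pos_pos) auto
    fix x
    have "Re (cnj l * cinner (A x) x) \<le> cmod l * (r * (norm x)\<^sup>2)"
      using complex_Re_le_cmod[of "cnj l * cinner (A x) x"] mult_left_mono[OF r(1)[of x] norm_ge_zero[of l]]
      by (simp add: norm_mult)
    moreover have "Re (cnj l * l * cinner x x) = cmod l * cmod l * (norm x)\<^sup>2"
      using complex_norm_square[of l, symmetric]
      by (simp add: cinner_self mult.commute[of "cnj l"] power2_eq_square del: of_real_power)
    ultimately show "cmod l * (cmod l - r) * (norm x)\<^sup>2
        \<le> Re (- cnj l * cinner (A x - l *\<^sub>C x) x)"
      unfolding cinner_diff_left cinner_scaleC_left
      by (simp add: algebra_simps)
  qed
  then show False using l by (simp add: op_spectrum_iff)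
qed

lemma spectrum_le_norm_bound:
  assumes A: "bounded_clinear A" and l: "l \<in> op_spectrum A"
    and k: "\<And>x. norm (A x) \<le> k * norm x" "0 \<le> k"
  shows "cmod l \<le> k"
proof (rule spectrum_le_quadratic_bound[OF A l _ k(2)])
  show "cmod (cinner (A x) x) \<le> k * (norm x)\<^sup>2" for x
    using cmod_cinner_le[of "A x" x] mult_right_mono[OF k(1)[of x] norm_ge_zero[of x]]
    by (simp add: power2_eq_square)
qed

lemma spectrum_bdd_above:
  assumes "bounded_clinear A"
  shows "bdd_above (cmod ` op_spectrum A)"
  using spectrum_le_norm_bound[OF assms _ bounded_clinear_onorm[OF assms]
      onorm_pos_le[OF bounded_clinearD(1)[OF assms]]]
  by (intro bdd_aboveI2)

lemma spectral_radius_upper: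
  "bounded_clinear A \<Longrightarrow> l \<in> op_spectrum A \<Longrightarrow> cmod l \<le> op_spectral_radius A"
  unfolding op_spectral_radius_def by (rule cSUP_upper[OF _ spectrum_bdd_above])

text \<open>Otherwise the resolvent would be a bounded entire function vanishing at infinity.\<close>

lemma spectrum_nonempty:
  fixes A :: "'a::complex_hilbert_space \<Rightarrow> 'a"
  assumes A: "bounded_clinear A" and x0: "x0 \<noteq> (0::'a)"
  shows "op_spectrum A \<noteq> {}"
proof
  assume "op_spectrum A = {}"
  then have "\<forall>z. \<exists>R. bounded_clinear R \<and> (\<forall>x. R (A x - z *\<^sub>C x) = x) \<and> (\<forall>x. A (R x) - z *\<^sub>C R x = x)"
    by (auto simp: op_spectrum_def fun_eq_iff)
  then obtain R where R: "\<And>z. bounded_clinear (R z)"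
    "\<And>z x. R z (A x - z *\<^sub>C x) = x" "\<And>z x. A (R z x) - z *\<^sub>C R z x = x"
    by metis
  note lR = bounded_clinearD[OF R(1)]
  \<comment> \<open>Resolvent identity: apply \<open>R w\<close> to x written as (A - w) R z x + (w
    - z) R z x.\<close>
  have res: "R w x - R z x = (w - z) *\<^sub>C R w (R z x)" for w z x
  proof -
    have "x = (A (R z x) - w *\<^sub>C R z x) + (w - z) *\<^sub>C R z x"
      using R(3)[of z x] by (simp add: scaleC_diff_left)
    then have "R w x = R w ((A (R z x) - w *\<^sub>C R z x) + (w - z) *\<^sub>C R z x)" by simp
    then show ?thesis by (simp only: lR(2,4) R(2)) simp
  qed
  \<comment> \<open>With the factors exchanged, the outer resolvent sits at the fixed point z, so
    one bound for \<open>R z\<close> serves for all nearby w.\<close>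
  have res': "R w x - R z x = (w - z) *\<^sub>C R z (R w x)" for w z x
  proof -
    have "R w x - R z x = - (R z x - R w x)" by simp
    also have "\<dots> = - ((z - w) *\<^sub>C R z (R w x))" by (simp only: res)
    finally show ?thesis by (simp add: scaleC_diff_left)
  qed
  have cont: "((\<lambda>w. R w x) \<longlongrightarrow> R z x) (at z)" for z x
  proof -
    obtain K where K: "K > 0" "\<And>y. norm (R z y) \<le> K * norm y"
      using bounded_clinear_boundE[OF R(1)] by metis
    have d: "norm (R w x - R z x) \<le> cmod (w - z) * K * norm (R w x)" for w
      using mult_left_mono[OF K(2)[of "R w x"] norm_ge_zero[of "w - z"]]
      by (simp add: res' norm_scaleC mult.assoc)
    \<comment> \<open>Within distance 1/(2K) the difference is at most half of ||R w x||. Absorbing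
      that half yields ||R w x|| \<le> 2 ||R z x||, which removes w from the bound.\<close>
    have "norm (R w x - R z x) \<le> cmod (w - z) * (2 * K * norm (R z x))"
      if "dist w z < 1 / (2 * K)" for w
    proof -
      have "cmod (w - z) * K \<le> 1 / 2" using that K(1) by (simp add: dist_norm field_simps)
      then have "cmod (w - z) * K * norm (R w x) \<le> 1 / 2 * norm (R w x)"
        by (rule mult_right_mono) simp
      then have "norm (R w x) \<le> 2 * norm (R z x)"
        using d[of w] norm_triangle_ineq2[of "R w x" "R z x"] by linarith
      then have "cmod (w - z) * K * norm (R w x) \<le> cmod (w - z) * K * (2 * norm (R z x))"
        using K(1) by (intro mult_left_mono) auto
      then show ?thesis using d[of w] by simp
    qed
    then have "\<forall>\<^sub>F w in at z. norm (R w x - R z x) \<le> cmod (w - z) * (2 * K * norm (R z x))"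
      using K(1) by (intro eventually_at[THEN iffD2] exI[of _ "1 / (2 * K)"]) auto
    moreover have "((\<lambda>w. cmod (w - z) * (2 * K * norm (R z x))) \<longlongrightarrow> 0) (at z)"
      by (auto intro!: tendsto_eq_intros)
    ultimately have "((\<lambda>w. R w x - R z x) \<longlongrightarrow> 0) (at z)"
      by (rule Lim_null_comparison)
    then show ?thesis by (rule LIM_zero_cancel)
  qed
  \<comment> \<open>Matrix coefficients make the resolvent scalar valued, as Liouville's theorem
    requires.\<close>
  define f where "f y x z = cinner (R z x) y" for y x z
  have der: "(f y x has_field_derivative cinner (R z (R z x)) y) (at z)" for y x z
  proof -
    have "((\<lambda>w. cinner (R w (R z x)) y) \<longlongrightarrow> cinner (R z (R z x)) y) (at z)"
      by (intro bounded_bilinear.tendsto[OF bounded_bilinear_cinner] cont tendsto_const)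
    moreover have "\<forall>\<^sub>F w in at z. cinner (R w (R z x)) y = (f y x w - f y x z) / (w - z)"
    proof -
      have "cinner (R w (R z x)) y = (f y x w - f y x z) / (w - z)" if "w \<noteq> z" for w
        using that by (simp only: f_def cinner_diff_left[symmetric] res[of w x z] cinner_scaleC_left) simp
      then show ?thesis by (simp add: eventually_at_filter)
    qed
    ultimately show ?thesis
      unfolding has_field_derivative_iff by (rule Lim_transform_eventually)
  qed
  have hol: "f y x holomorphic_on UNIV" for y x
    using der by (auto simp: holomorphic_on_def field_differentiable_def)
  have lim: "(f y x \<longlongrightarrow> 0) at_infinity" for y x
  proof (rule Lim_null_comparison)
    have "norm (f y x z) \<le> norm x * norm y / (cmod z - onorm A)" if "onorm A + 1 \<le> cmod z" for z
    proof -
      have "cmod z * norm (R z x) \<le> norm (A (R z x)) + norm x"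
        using norm_triangle_ineq2[of "z *\<^sub>C R z x" "A (R z x)"] R(3)[of z x]
        by (metis add.commute diff_le_eq norm_minus_commute norm_scaleC)
      then have "(cmod z - onorm A) * norm (R z x) \<le> norm x"
        using bounded_clinear_onorm[OF A, of "R z x"] by (simp add: algebra_simps)
      then have "norm (R z x) \<le> norm x / (cmod z - onorm A)"
        using that by (simp add: field_simps)
      then have "norm (R z x) * norm y \<le> norm x / (cmod z - onorm A) * norm y"
        by (rule mult_right_mono) simp
      then show ?thesis using cmod_cinner_le[of "R z x" y] by (simp add: f_def)
    qed
    then show "\<forall>\<^sub>F z in at_infinity. norm (f y x z) \<le> norm x * norm y / (cmod z - onorm A)"
      by (auto simp: eventually_at_infinity)
    have "filterlim (\<lambda>z::complex. - onorm A + cmod z) at_top at_infinity"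
      by (intro filterlim_tendsto_add_at_top[OF tendsto_const] filterlim_norm_at_top)
    then show "((\<lambda>z. norm x * norm y / (cmod z - onorm A)) \<longlongrightarrow> 0) at_infinity"
      by (intro tendsto_divide_0[OF tendsto_const] filterlim_at_top_imp_at_infinity) simp
  qed
  \<comment> \<open>Pairing with y = R 0 x0 makes the value at 0 the squared norm of R 0 x0.\<close>
  have "f (R 0 x0) x0 0 = 0" by (rule Liouville_weak_0[OF hol lim])
  then have "R 0 x0 = 0" by (simp add: f_def cinner_self)
  then show False using R(3)[of 0 x0] x0 by (simp add: bounded_clinearD[OF A])
qed

text \<open>Nonemptiness of the spectrum is what lets a pointwise bound pass to the supremum in
  \<open>op_spectral_radius\<close>.\<close>

lemma spectral_radius_leI:
  fixes A :: "'a::complex_hilbert_space \<Rightarrow> 'a"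
  assumes "bounded_clinear A" "x0 \<noteq> (0::'a)"
    and "\<And>l. l \<in> op_spectrum A \<Longrightarrow> cmod l \<le> k"
  shows "op_spectral_radius A \<le> k"
  unfolding op_spectral_radius_def using spectrum_nonempty[OF assms(1,2)] assms(3)
  by (intro cSUP_least) auto

lemma eigenvalue_in_spectrum:
  assumes "bounded_clinear A" "A x = l *\<^sub>C x" "x \<noteq> 0"
  shows "l \<in> op_spectrum A"
proof (rule ccontr)
  assume "l \<notin> op_spectrum A"
  then have "op_invertible (\<lambda>x. A x - l *\<^sub>C x)" by (simp add: op_spectrum_iff)
  then obtain c where "c > 0" "\<And>x. c * norm x \<le> norm (A x - l *\<^sub>C x)"
    using op_invertible_bounded_below by blast
  from this(1) this(2)[of x] show False using assms by (simp add: mult_le_0_iff)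
qed

section \<open>Half contractions and the rank one condition\<close>

lemma onorm_le_iff:
  assumes "bounded_clinear A" "0 \<le> k"
  shows "onorm A \<le> k \<longleftrightarrow> (\<forall>x. norm (A x) \<le> k * norm x)"
  using bounded_clinear_onorm[OF assms(1)] onorm_bound[OF assms(2)]
  by (meson mult_right_mono norm_ge_zero order_trans)

text \<open>With E = (\<mu>/2) B and S = E - l, the operator to be inverted factors as (I + L E
  S^{-1}) S. The form of E is bounded by |\<mu>| r / 2, so S exists as an invertible operator and
  ||E x||^2 \<le> ||S x||^2 - \<delta> ||x||^2. Hence E S^{-1} is a strict contraction, and
  composing with L keeps it one.\<close>

lemma spectrum_product_bound:
  assumes L: "bounded_clinear L" "\<And>x. norm (L x) \<le> norm x" and B: "bounded_clinear B"
    and r: "\<And>x. cmod (cinner (B x) x) \<le> r * (norm x)\<^sup>2" "0 \<le> r"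
    and l: "l \<in> op_spectrum (\<lambda>x. (\<mu> / 2) *\<^sub>C (B x + L (B x)))"
  shows "cmod l \<le> cmod \<mu> * r"
proof (rule ccontr)
  assume "\<not> cmod l \<le> cmod \<mu> * r"
  then have gt: "cmod l > cmod \<mu> * r" by simp
  define E where "E x = (\<mu> / 2) *\<^sub>C B x" for x
  have E: "bounded_clinear E" unfolding E_def by (rule bounded_clinear_scaleC_comp[OF B])
  have qE: "cmod (cinner (E x) x) \<le> cmod \<mu> * r / 2 * (norm x)\<^sup>2" for x
    using mult_left_mono[OF r(1)[of x], of "cmod \<mu> / 2"]
    by (simp add: E_def cinner_scaleC_left norm_mult)
  define S where "S x = E x - l *\<^sub>C x" for x
  have S: "bounded_clinear S" unfolding S_def by (rule bounded_clinear_minus_scaleC[OF E])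
  have "cmod \<mu> * r / 2 < cmod l" using gt mult_nonneg_nonneg[OF norm_ge_zero[of \<mu>] r(2)] by linarith
  then have "l \<notin> op_spectrum E"
    using spectrum_le_quadratic_bound[OF E _ qE] r(2) by fastforce
  then have invS: "op_invertible S" by (simp add: op_spectrum_iff S_def[abs_def])
  then obtain G where G: "bounded_clinear G" "\<And>x. G (S x) = x" "\<And>x. S (G x) = x"
    by (rule op_invertibleE) blast
  \<comment> \<open>The coefficient |l|^2 - 2 |l| (|\<mu>| r / 2) left over when ||E x - l x||^2 is
    expanded.\<close>
  define \<delta> where "\<delta> = cmod l * (cmod l - cmod \<mu> * r)"
  have l0: "cmod l > 0" using gt mult_nonneg_nonneg[OF norm_ge_zero[of \<mu>] r(2)] by linarith
  have \<delta>: "\<delta> > 0" unfolding \<delta>_def using gt l0 by (intro mult_pos_pos) auto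
  have gap: "(norm (E x))\<^sup>2 \<le> (norm (S x))\<^sup>2 - \<delta> * (norm x)\<^sup>2" for x
  proof -
    have "Re (cinner (E x) (l *\<^sub>C x)) \<le> cmod l * (cmod \<mu> * r / 2 * (norm x)\<^sup>2)"
      using mult_left_mono[OF qE[of x] norm_ge_zero[of l]]
        complex_Re_le_cmod[of "cinner (E x) (l *\<^sub>C x)"]
      by (simp add: cinner_scaleC_right norm_mult)
    then show ?thesis
      unfolding S_def norm_diff_sq norm_scaleC \<delta>_def
      by (simp add: algebra_simps power2_eq_square)
  qed
  obtain M where M: "M > 0" "\<And>x. norm (S x) \<le> M * norm x"
    using bounded_clinear_boundE[OF S] by metis
  \<comment> \<open>For y = S x the upper bound M of S converts the gap \<delta> ||x||^2 into at
    least (\<delta> / M^2) ||y||^2.\<close>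
  define q where "q = sqrt (max 0 (1 - \<delta> / M\<^sup>2))"
  have q1: "q < 1" using \<delta> M(1) by (auto simp: q_def max_def)
  have EG: "norm (E (G y)) \<le> q * norm y" for y
  proof -
    have "(norm y)\<^sup>2 \<le> (M * norm (G y))\<^sup>2"
      using M(2)[of "G y"] by (simp add: G power_mono)
    then have "\<delta> / M\<^sup>2 * (norm y)\<^sup>2 \<le> \<delta> * (norm (G y))\<^sup>2"
      using \<delta> M(1) by (simp add: field_simps power_mult_distrib)
    then have "(norm (E (G y)))\<^sup>2 \<le> (1 - \<delta> / M\<^sup>2) * (norm y)\<^sup>2"
      using gap[of "G y"] by (simp add: G algebra_simps)
    also have "\<dots> \<le> max 0 (1 - \<delta> / M\<^sup>2) * (norm y)\<^sup>2" by (intro mult_right_mono) auto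
    also have "\<dots> = (q * norm y)\<^sup>2" by (simp add: q_def power_mult_distrib)
    finally show ?thesis by (rule power2_le_imp_le) (simp add: q_def)
  qed
  define P where "P y = - 1 *\<^sub>C L (E (G y))" for y
  have "op_invertible (\<lambda>y. y - P y)"
  proof (rule neumann_invertible[OF _ q1])
    show "bounded_clinear P" unfolding P_def
      by (intro bounded_clinear_scaleC_comp bounded_clinear_comp[OF L(1)] bounded_clinear_comp[OF E] G)
    show "norm (P y) \<le> q * norm y" for y
      using order_trans[OF L(2) EG] by (simp add: P_def norm_scaleC)
  qed
  from op_invertible_comp[OF this invS]
  have "op_invertible (\<lambda>x. S x - P (S x))" .
  moreover have "S x - P (S x) = (\<mu> / 2) *\<^sub>C (B x + L (B x)) - l *\<^sub>C x" for x
    unfolding P_def G by (simp add: S_def E_def bounded_clinearD[OF L(1)] scaleC_add_right)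
  ultimately show False using l by (simp add: op_spectrum_iff)
qed

text \<open>Affine case of spectral mapping: the two shifted operators differ by the factor \<mu>/2.
  The value l = 1 corresponds to \<mu>.\<close>

lemma spectrum_half_shift:
  assumes "\<mu> \<noteq> 0"
  shows "(\<mu> / 2) * (1 + l) \<in> op_spectrum (\<lambda>x. (\<mu> / 2) *\<^sub>C (x + L x)) \<longleftrightarrow> l \<in> op_spectrum L"
proof -
  have "(\<mu> / 2) *\<^sub>C (x + L x) - ((\<mu> / 2) * (1 + l)) *\<^sub>C x = (\<mu> / 2) *\<^sub>C (L x - l *\<^sub>C x)" for x
    by (simp add: distrib_left scaleC_add_right scaleC_diff_right scaleC_scaleC scaleC_add_left)
  then show ?thesis
    using assms op_invertible_scaleC_comp[of "\<mu> / 2" "\<lambda>x. L x - l *\<^sub>C x"] by (simp add: op_spectrum_iff)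
qed

lemma contraction_iff:
  "contraction L \<longleftrightarrow> bounded_clinear L \<and> (\<forall>x. norm (L x) \<le> norm x)"
  using onorm_le_iff[of L 1] by (auto simp: contraction_def)

text \<open>Among the points of the closed unit disk, only 1 has distance 2 from -1. This is the
  source of the uniqueness of the peripheral spectral value.\<close>

lemma unit_disk_extreme:
  assumes "cmod l \<le> 1" "cmod (1 + l) = 2"
  shows "l = 1"
proof -
  have s: "(Re l)\<^sup>2 + (Im l)\<^sup>2 \<le> 1" using power_mono[OF assms(1), of 2] by (simp add: cmod_power2)
  have "(1 + Re l)\<^sup>2 + (Im l)\<^sup>2 = 4" using assms(2) cmod_power2[of "1 + l"] by simp
  then have "1 \<le> Re l" using s by (simp add: power2_eq_square algebra_simps)
  moreover have "Re l \<le> 1" using complex_Re_le_cmod[of l] assms(1) by linarith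
  ultimately have "Re l = 1" by simp
  then show ?thesis using s by (simp add: complex_eq_iff)
qed

text \<open>The correspondence is L = 2 A / \<mu> - I. The spectrum of A is the image of a subset of
  the closed unit disk under l \<mapsto> (\<mu>/2)(1 + l), so its moduli are at most |\<mu>|, with
  equality only for l = 1. This fixes the spectral radius and gives uniqueness together.\<close>

lemma peripheral_iff_contraction:
  fixes A :: "'a::complex_hilbert_space \<Rightarrow> 'a"
  assumes A: "bounded_clinear A" and A0: "A x0 \<noteq> 0"
  shows "unique_peripheral A \<mu> \<and> \<mu> \<noteq> 0 \<and> onorm (\<lambda>x. (1 / \<mu>) *\<^sub>C A x - (1 / 2) *\<^sub>C x) \<le> 1 / 2 \<longleftrightarrow>
    (\<exists>L. contraction L \<and> 1 \<in> op_spectrum L \<and> A = (\<lambda>x. (\<mu> / 2) *\<^sub>C (x + L x)))"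
    (is "?l \<longleftrightarrow> ?r")
proof
  assume ?l
  then have up: "unique_peripheral A \<mu>" and m: "\<mu> \<noteq> 0"
    and n: "onorm (\<lambda>x. (1 / \<mu>) *\<^sub>C A x - (1 / 2) *\<^sub>C x) \<le> 1 / 2" by auto
  define L where "L x = (2 / \<mu>) *\<^sub>C A x - x" for x
  have L: "bounded_clinear L" unfolding L_def
    by (intro bounded_clinear_diff bounded_clinear_scaleC_comp A bounded_clinear_ident)
  have AL: "A = (\<lambda>x. (\<mu> / 2) *\<^sub>C (x + L x))" using m by (simp add: L_def scaleC_scaleC)
  have "norm (L x) \<le> norm x" for x
  proof -
    have "norm ((1 / \<mu>) *\<^sub>C A x - (1 / 2) *\<^sub>C x) \<le> 1 / 2 * norm x"
      using n by (subst (asm) onorm_le_iff)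
        (auto intro!: bounded_clinear_diff bounded_clinear_scaleC_comp A bounded_clinear_ident)
    moreover have "L x = 2 *\<^sub>C ((1 / \<mu>) *\<^sub>C A x - (1 / 2) *\<^sub>C x)"
      by (simp add: L_def scaleC_diff_right scaleC_scaleC)
    ultimately show ?thesis by (simp add: norm_scaleC)
  qed
  then have "contraction L" using L by (simp add: contraction_iff)
  moreover have "1 \<in> op_spectrum L"
    using spectrum_half_shift[OF m, of 1 L] up unfolding AL[symmetric] by (simp add: unique_peripheral_def)
  ultimately show ?r using AL by blast
next
  assume ?r
  then obtain L where L: "bounded_clinear L" "\<And>x. norm (L x) \<le> norm x" and s1: "1 \<in> op_spectrum L"
    and AL: "A = (\<lambda>x. (\<mu> / 2) *\<^sub>C (x + L x))" by (auto simp: contraction_iff)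
  have m: "\<mu> \<noteq> 0" using A0 AL by auto
  have x0: "x0 \<noteq> 0" using A0 bounded_clinearD(5)[OF A] by auto
  have ms: "\<mu> \<in> op_spectrum A"
    using spectrum_half_shift[OF m, of 1 L] s1 unfolding AL[symmetric] by simp
  have le: "cmod \<nu> \<le> cmod \<mu>" and eq: "cmod \<nu> = cmod \<mu> \<Longrightarrow> \<nu> = \<mu>" if "\<nu> \<in> op_spectrum A" for \<nu>
  proof -
    define l where "l = 2 * \<nu> / \<mu> - 1"
    have \<nu>: "\<nu> = (\<mu> / 2) * (1 + l)" using m by (simp add: l_def)
    have "l \<in> op_spectrum L"
      using that spectrum_half_shift[OF m, of l L] unfolding AL[symmetric] \<nu>[symmetric] by simp
    then have l1: "cmod l \<le> 1" using spectrum_le_norm_bound[OF L(1), of l 1] L(2) by simp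
    then have "cmod (1 + l) \<le> 2" using norm_triangle_ineq[of 1 l] by simp
    then show "cmod \<nu> \<le> cmod \<mu>" unfolding \<nu> norm_mult
      using mult_left_mono[of "cmod (1 + l)" 2 "cmod \<mu> / 2"] by (simp add: norm_divide)
    show "\<nu> = \<mu>" if "cmod \<nu> = cmod \<mu>"
    proof -
      have "cmod (1 + l) = 2" using that m unfolding \<nu> norm_mult by (simp add: norm_divide)
      then show ?thesis using unit_disk_extreme[OF l1] \<nu> by simp
    qed
  qed
  have "op_spectral_radius A = cmod \<mu>"
    using spectral_radius_leI[OF A x0 le] spectral_radius_upper[OF A ms] by simp
  then have "unique_peripheral A \<mu>" using ms eq by (auto simp: unique_peripheral_def)
  moreover have "onorm (\<lambda>x. (1 / \<mu>) *\<^sub>C A x - (1 / 2) *\<^sub>C x) \<le> 1 / 2"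
  proof (rule onorm_bound)
    fix x
    have "(1 / \<mu>) *\<^sub>C A x - (1 / 2) *\<^sub>C x = (1 / 2) *\<^sub>C L x"
      using m by (simp add: AL scaleC_scaleC scaleC_add_right)
    then show "norm ((1 / \<mu>) *\<^sub>C A x - (1 / 2) *\<^sub>C x) \<le> 1 / 2 * norm x"
      using L(2)[of x] by (simp add: norm_scaleC norm_divide)
  qed simp
  ultimately show ?l using m by blast
qed

text \<open>\<open>spectrum_product_bound\<close> gives |\<mu>| r(B); since \<mu> lies in the
  spectrum of A, |\<mu>| \<le> r(A).\<close>

lemma half_contraction_spectral_bound:
  fixes A :: "'a::complex_hilbert_space \<Rightarrow> 'a"
  assumes A: "bounded_clinear A" and L: "contraction L" "1 \<in> op_spectrum L"
    and AL: "A = (\<lambda>x. (\<mu> / 2) *\<^sub>C (x + L x))" and A0: "A x0 \<noteq> 0" and B: "bounded_clinear B"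
  shows "op_spectral_radius (A \<circ> B) \<le> numerical_radius A * numerical_radius B"
proof -
  have m: "\<mu> \<noteq> 0" using A0 AL by auto
  have x0: "x0 \<noteq> 0" using A0 bounded_clinearD(5)[OF A] by auto
  note nn = numerical_radius_nonneg[OF _ x0]
  have "\<mu> \<in> op_spectrum A"
    using spectrum_half_shift[OF m, of 1 L] L(2) unfolding AL[symmetric] by simp
  then have mA: "cmod \<mu> \<le> numerical_radius A"
    by (rule spectrum_le_quadratic_bound[OF A _ numerical_radius_bound[OF A] nn[OF A]])
  have L': "bounded_clinear L" "\<And>x. norm (L x) \<le> norm x" using L(1) by (auto simp: contraction_iff)
  have AB: "A \<circ> B = (\<lambda>x. (\<mu> / 2) *\<^sub>C (B x + L (B x)))" by (simp add: AL comp_def)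
  have "op_spectral_radius (A \<circ> B) \<le> cmod \<mu> * numerical_radius B"
  proof (rule spectral_radius_leI[OF _ x0])
    show "bounded_clinear (A \<circ> B)" using bounded_clinear_comp[OF A B] by (simp add: comp_def)
    show "cmod l \<le> cmod \<mu> * numerical_radius B" if "l \<in> op_spectrum (A \<circ> B)" for l
      using spectrum_product_bound[OF L' B numerical_radius_bound[OF B] nn[OF B]] that
      unfolding AB by blast
  qed
  also have "\<dots> \<le> numerical_radius A * numerical_radius B"
    by (rule mult_right_mono[OF mA nn[OF B]])
  finally show ?thesis .
qed

section \<open>The test operators v u^* and Buzano's inequality\<close>

definition rank_one_op :: "'a \<Rightarrow> 'a \<Rightarrow> 'a \<Rightarrow> 'a::complex_hilbert_space" where
  "rank_one_op u v x = cinner x u *\<^sub>C v"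

lemma bounded_clinear_rank_one_op: "bounded_clinear (rank_one_op u v)"
proof (rule bounded_clinearI)
  show "norm (rank_one_op u v x) \<le> (norm u * norm v) * norm x" for x
    using mult_right_mono[OF cmod_cinner_le[of x u] norm_ge_zero[of v]]
    by (simp add: rank_one_op_def norm_scaleC mult_ac)
qed (simp_all add: rank_one_op_def cinner_add_left scaleC_add_left cinner_scaleC_left scaleC_scaleC)

lemma rank_one_rank_one_op:
  assumes "u \<noteq> 0" "v \<noteq> 0"
  shows "rank_one (rank_one_op u v)"
proof -
  have "range (rank_one_op u v) = cspan {v}"
  proof -
    have "c *\<^sub>C v \<in> range (rank_one_op u v)" for c
    proof
      show "c *\<^sub>C v = rank_one_op u v ((c / cinner u u) *\<^sub>C u)"
        using assms(1) by (simp add: rank_one_op_def cinner_scaleC_left cinner_self)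
    qed simp
    then show ?thesis by (auto simp: complex_vector.span_singleton rank_one_op_def)
  qed
  then show ?thesis
    using assms(2) complex_vector.dim_eq_card_independent[of "{v}"]
    by (simp add: rank_one_def complex_vector.dim_span complex_vector.dependent_single)
qed

text \<open>With P the projection onto x, the vector y = (2 P - I) v / 2 is half a reflection of v,
  so it has norm ||v|| / 2. Cauchy-Schwarz for (y, u) then leaves only the term (v, u) / 2.\<close>

lemma buzano:
  assumes "norm x = 1"
  shows "cmod (cinner v x * cinner x u) \<le> (norm u * norm v + cmod (cinner v u)) / 2"
proof -
  define y where "y = cinner v x *\<^sub>C x - (1 / 2) *\<^sub>C v"
  have "Re (cinner v x * cinner x v) = (cmod (cinner v x))\<^sup>2"
    by (subst cinner_commute[of x v]) (simp add: complex_norm_square[symmetric] del: of_real_power)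
  then have "(norm y)\<^sup>2 = (norm v / 2)\<^sup>2"
    using assms by (simp add: y_def norm_diff_sq norm_scaleC norm_divide cinner_scaleC_left
        cinner_scaleC_right power_divide)
  then have "norm y = norm v / 2" by (simp add: power2_eq_iff_nonneg)
  then have "cmod (cinner y u) \<le> norm v / 2 * norm u" using cmod_cinner_le[of y u] by (simp only:)
  moreover have "cinner v x * cinner x u = cinner y u + cinner v u / 2"
    by (simp add: y_def cinner_diff_left cinner_scaleC_left)
  ultimately show ?thesis
    using norm_triangle_ineq[of "cinner y u" "cinner v u / 2"] by (simp add: norm_divide mult.commute)
qed

text \<open>For B = v u^*, the vector A v is an eigenvector of A B with eigenvalue (A v, u), while
  Buzano's inequality bounds r(B).\<close>

lemma rank_one_condition_form_bound:
  fixes A :: "'a::complex_hilbert_space \<Rightarrow> 'a"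
  assumes A: "bounded_clinear A"
    and b: "\<And>B. bounded_clinear B \<Longrightarrow> rank_one B \<Longrightarrow>
      op_spectral_radius (A \<circ> B) \<le> numerical_radius A * numerical_radius B"
    and x0: "x0 \<noteq> (0::'a)"
  shows "2 * cmod (cinner (A v) u) \<le> numerical_radius A * (norm u * norm v + cmod (cinner v u))"
\<comment> \<open>In these cases the left side vanishes; otherwise the eigenvector A v is nonzero
  and B has rank one.\<close>
proof (cases "A v = 0 \<or> u = 0")
  case True
  then show ?thesis using numerical_radius_nonneg[OF A x0] by auto
next
  case False
  then have v: "v \<noteq> 0" using bounded_clinearD(5)[OF A] by auto
  define B where "B = rank_one_op u v"
  have B: "bounded_clinear B" unfolding B_def by (rule bounded_clinear_rank_one_op)
  have AB: "bounded_clinear (A \<circ> B)" using bounded_clinear_comp[OF A B] by (simp add: comp_def)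
  have "cinner (A v) u \<in> op_spectrum (A \<circ> B)"
    using False by (intro eigenvalue_in_spectrum[OF AB, of "A v"])
      (simp_all add: B_def rank_one_op_def bounded_clinearD[OF A])
  then have "cmod (cinner (A v) u) \<le> op_spectral_radius (A \<circ> B)" by (rule spectral_radius_upper[OF AB])
  also have "\<dots> \<le> numerical_radius A * numerical_radius B"
    using False v by (intro b B) (simp add: B_def rank_one_rank_one_op)
  also have "\<dots> \<le> numerical_radius A * ((norm u * norm v + cmod (cinner v u)) / 2)"
  proof (rule mult_left_mono[OF numerical_radius_leI[OF x0] numerical_radius_nonneg[OF A x0]])
    show "cmod (cinner (B x) x) \<le> (norm u * norm v + cmod (cinner v u)) / 2" if "norm x = 1" for x
      using buzano[OF that, of v u] by (simp add: B_def rank_one_op_def cinner_scaleC_left mult.commute)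
  qed
  finally show ?thesis by simp
qed

section \<open>From the rank one condition to a contraction\<close>

text \<open>Multiplying by |z| linearises the modulus, because |k + z| |z| \<ge> Re (k conj z) +
  |z|^2. The mean inequality replaces ||u|| ||v|| by ||u - v||^2 / 2 + Re z, and the |z|^2 terms
  cancel. Replacing conj z by 1 costs |k| |z - 1|, which is small when z is near 1.\<close>

lemma form_condition_phase:
  assumes "2 * cmod (k + z) \<le> norm u * norm v + cmod z" and z: "z = cinner v u"
  shows "4 * Re k \<le> (1 + cmod (z - 1)) * (norm (u - v))\<^sup>2 + 4 * (cmod k * cmod (z - 1))"
proof -
  have "norm u * norm v \<le> ((norm u)\<^sup>2 + (norm v)\<^sup>2) / 2"
    using sum_squares_bound[of "norm u" "norm v"] by simp
  also have "\<dots> = (norm (u - v))\<^sup>2 / 2 + Re z"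
    by (simp add: norm_diff_sq z cinner_commute[of u v] field_simps)
  finally have uv: "norm u * norm v \<le> (norm (u - v))\<^sup>2 / 2 + cmod z"
    using complex_Re_le_cmod[of z] by linarith
  have "Re ((k + z) * cnj z) \<le> cmod (k + z) * cmod z"
    using complex_Re_le_cmod[of "(k + z) * cnj z"] by (simp add: norm_mult)
  moreover have "Re ((k + z) * cnj z) = Re (k * cnj z) + cmod z * cmod z"
    using complex_norm_square[of z, symmetric] by (simp add: distrib_right power2_eq_square del: of_real_power)
  ultimately have "2 * Re (k * cnj z) + 2 * cmod z * cmod z \<le> 2 * cmod (k + z) * cmod z" by simp
  also have "\<dots> \<le> ((norm (u - v))\<^sup>2 / 2 + cmod z + cmod z) * cmod z"
    using assms(1) uv by (intro mult_right_mono) auto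
  finally have "4 * Re (k * cnj z) \<le> cmod z * (norm (u - v))\<^sup>2" by (simp add: algebra_simps)
  also have "\<dots> \<le> (1 + cmod (z - 1)) * (norm (u - v))\<^sup>2"
    using norm_triangle_ineq[of 1 "z - 1"] by (intro mult_right_mono) auto
  finally have 1: "4 * Re (k * cnj z) \<le> (1 + cmod (z - 1)) * (norm (u - v))\<^sup>2" .
  have 2: "Re k = Re (k * cnj z) - Re (k * cnj (z - 1))"
    by (simp add: algebra_simps)
  have "cmod (k * cnj (z - 1)) = cmod k * cmod (z - 1)" by (simp only: norm_mult complex_mod_cnj)
  then have 3: "- Re (k * cnj (z - 1)) \<le> cmod k * cmod (z - 1)"
    using abs_Re_le_cmod[of "k * cnj (z - 1)"] by linarith
  have arith: "4 * (p - q) \<le> b + 4 * c" if "4 * p \<le> b" "- q \<le> c" for p q b c :: real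
    using that by simp
  show ?thesis unfolding 2 by (rule arith[OF 1 3])
qed

text \<open>Hypothesis \<open>form\<close> is the rank one condition for \<open>I + K\<close>, normalised to numerical radius \<open>1\<close>. It
  is tested on pairs near a unit vector that almost attains the numerical radius.\<close>

locale rank_one_condition =
  fixes K :: "'a::complex_hilbert_space \<Rightarrow> 'a" and M :: real
  assumes K: "bounded_clinear K" and M: "0 < M" "\<And>x. norm (K x) \<le> M * norm x"
    and form: "\<And>u v. 2 * cmod (cinner (K v) u + cinner v u) \<le> norm u * norm v + cmod (cinner v u)"
begin

lemma second_order:
  "4 * Re (cinner (K v) u) \<le> (1 + cmod (cinner v u - 1)) * (norm (u - v))\<^sup>2
    + 4 * (cmod (cinner (K v) u) * cmod (cinner v u - 1))"
  by (rule form_condition_phase[OF form refl])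

lemma form_le: "norm x \<le> 1 \<Longrightarrow> norm y \<le> 1 \<Longrightarrow> cmod (cinner (K x) y) \<le> M"
proof -
  assume x: "norm x \<le> 1" and y: "norm y \<le> 1"
  have "cmod (cinner (K x) y) \<le> norm (K x) * norm y" by (rule cmod_cinner_le)
  also have "\<dots> \<le> (M * norm x) * norm y" by (intro mult_right_mono M(2)) simp
  also have "\<dots> \<le> M" using mult_le_one[OF x _ y] M(1) by (simp add: mult.assoc)
  finally show ?thesis .
qed

lemma cmod_cinner_le_1: "norm x \<le> 1 \<Longrightarrow> norm y \<le> 1 \<Longrightarrow> cmod (cinner x (y :: 'a)) \<le> 1"
  using cmod_cinner_le[of x y] mult_le_one[of "norm x" "norm y"] by auto

text \<open>Here \<open>k0\<close> and \<open>k1\<close> are the constant and linear coefficients of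
  the form of K along a perturbation of size e, and e \<open>z1\<close> is the deviation of the
  inner product from 1. Every term except the linear one is of order e^2, so Re \<open>k1\<close> is
  of order e.\<close>

lemma first_order_aux:
  assumes e: "0 < e" "e \<le> 1" and k0: "cmod k0 \<le> e\<^sup>2" and k1: "cmod k1 \<le> M" and z1: "cmod z1 \<le> 1"
    and n: "d \<le> e" "0 \<le> d"
    and le: "4 * Re (k0 + of_real e * k1) \<le> (1 + cmod (of_real e * z1)) * d\<^sup>2
      + 4 * (cmod (k0 + of_real e * k1) * cmod (of_real e * z1))"
  shows "Re k1 \<le> (4 + M) * e"
proof -
  have z: "cmod (of_real e * z1) \<le> e" using e z1 by (simp add: norm_mult mult_left_le)
  have e2: "e\<^sup>2 \<le> e" using e by (simp add: power2_eq_square mult_left_le)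
  have "cmod (k0 + of_real e * k1) \<le> cmod k0 + e * cmod k1"
    using norm_triangle_ineq[of k0 "of_real e * k1"] e by (simp add: norm_mult)
  also have "\<dots> \<le> e + e * M" using k0 e2 mult_left_mono[OF k1, of e] e by linarith
  finally have kk: "cmod (k0 + of_real e * k1) \<le> e + e * M" .
  have "(1 + cmod (of_real e * z1)) * d\<^sup>2 \<le> 2 * e\<^sup>2"
    using z e n by (intro mult_mono power_mono) auto
  moreover have "cmod (k0 + of_real e * k1) * cmod (of_real e * z1) \<le> (e + e * M) * e"
    using z kk e M(1) by (intro mult_mono) auto
  moreover have "- Re k0 \<le> e\<^sup>2" using abs_Re_le_cmod[of k0] k0 by linarith
  ultimately have "4 * (e * Re k1) \<le> 4 * e\<^sup>2 + 2 * e\<^sup>2 + 4 * ((e + e * M) * e)" using le by simp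
  \<comment> \<open>The left side is (10 + 4 M) e^2; 4 + M is a rounded quarter of its
    coefficient.\<close>
  also have "\<dots> \<le> 4 * (e * ((4 + M) * e))" by (simp add: power2_eq_square algebra_simps)
  finally show ?thesis using e by simp
qed

text \<open>Perturbing only the second argument of the form shows that K v is small.\<close>

lemma first_order_left:
  assumes v: "norm v = 1" and e: "0 < e" "e \<le> 1" and d: "cmod (cinner (K v) v) \<le> e\<^sup>2"
    and x: "norm x \<le> 1"
  shows "cmod (cinner (K v) x) \<le> (4 + M) * e"
proof -
  obtain w where w: "cmod w = 1" "w * cinner (K v) x = of_real (cmod (cinner (K v) x))"
    by (rule phase_exists)
  \<comment> \<open>The phase is conjugated because the second argument is antilinear.\<close>
  define y where "y = cnj w *\<^sub>C x"
  have y: "norm y \<le> 1" using x w by (simp add: y_def norm_scaleC)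
  define u where "u = v + of_real e *\<^sub>C y"
  have 1: "cinner (K v) u = cinner (K v) v + of_real e * cinner (K v) y"
    by (simp add: u_def cinner_add_right cinner_scaleC_right)
  have 2: "cinner v u - 1 = of_real e * cinner v y"
    using v by (simp add: u_def cinner_add_right cinner_scaleC_right cinner_self)
  have 3: "norm (u - v) \<le> e" using e y by (simp add: u_def norm_scaleC mult_left_le)
  have "Re (cinner (K v) y) \<le> (4 + M) * e"
    using second_order[of v u] v y unfolding 1 2
    by (intro first_order_aux[OF e d form_le cmod_cinner_le_1 3 norm_ge_zero]) auto
  then show ?thesis using w by (simp add: y_def cinner_scaleC_right)
qed

text \<open>Perturbing only the first argument shows that v is nearly orthogonal to the range of
  K.\<close>

lemma first_order_right:
  assumes v: "norm v = 1" and e: "0 < e" "e \<le> 1" and d: "cmod (cinner (K v) v) \<le> e\<^sup>2"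
    and x: "norm x \<le> 1"
  shows "cmod (cinner (K x) v) \<le> (4 + M) * e"
proof -
  obtain w where w: "cmod w = 1" "w * cinner (K x) v = of_real (cmod (cinner (K x) v))"
    by (rule phase_exists)
  define y where "y = w *\<^sub>C x"
  have y: "norm y \<le> 1" using x w by (simp add: y_def norm_scaleC)
  define u where "u = v + of_real e *\<^sub>C y"
  have 1: "cinner (K u) v = cinner (K v) v + of_real e * cinner (K y) v"
    by (simp add: u_def cinner_add_left cinner_scaleC_left bounded_clinearD[OF K])
  have 2: "cinner u v - 1 = of_real e * cinner y v"
    using v by (simp add: u_def cinner_add_left cinner_scaleC_left cinner_self)
  have 3: "norm (v - u) \<le> e" using e y by (simp add: u_def norm_scaleC mult_left_le)
  have "Re (cinner (K y) v) \<le> (4 + M) * e"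
    using second_order[of u v] v y unfolding 1 2
    by (intro first_order_aux[OF e d form_le cmod_cinner_le_1 3 norm_ge_zero]) auto
  then show ?thesis using w by (simp add: y_def cinner_scaleC_left bounded_clinearD[OF K])
qed

text \<open>At a = v + e x and b = v + e y the terms linear in e must be negligible against e^2.
  Attainment up to e^6 allows the first order lemmas to be used at scale e^3, so these terms are of
  order e^4. Division by e^2 then leaves a remainder of order e.\<close>

lemma second_order_limit_aux:
  assumes v: "norm v = 1" and e: "0 < e" "e \<le> 1" and d: "cmod (cinner (K v) v) \<le> (e ^ 3)\<^sup>2"
    and x: "norm x \<le> 1" and y: "norm y \<le> 1"
  shows "4 * Re (cinner (K x) y) \<le> (norm (y - x))\<^sup>2 + (160 + 100 * M) * e"
proof -
  define C where "C = 4 + M"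
  have C: "0 \<le> C" using M(1) by (simp add: C_def)
  have e3: "0 < e ^ 3" "e ^ 3 \<le> 1" using e by (simp_all add: power_le_one)
  define E :: complex where "E = of_real e"
  have nE: "cmod E = e" using e by (simp add: E_def)
  define a where "a = v + E *\<^sub>C x"
  define b where "b = v + E *\<^sub>C y"
  define k where "k = cinner (K v) v + E * cinner (K v) y + E * cinner (K x) v"
  have 1: "cinner (K a) b = k + E * E * cinner (K x) y"
    by (simp add: k_def E_def a_def b_def cinner_add_left cinner_add_right cinner_scaleC_left
        cinner_scaleC_right bounded_clinearD[OF K] algebra_simps)
  have 2: "cinner a b - 1 = E * cinner v y + E * cinner x v + E * E * cinner x y"
    using v by (simp add: E_def a_def b_def cinner_add_left cinner_add_right cinner_scaleC_left
        cinner_scaleC_right cinner_self algebra_simps)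
  have 3: "(norm (b - a))\<^sup>2 = e\<^sup>2 * (norm (y - x))\<^sup>2"
    using nE by (simp add: a_def b_def scaleC_diff_right[symmetric] norm_scaleC power_mult_distrib)
  \<comment> \<open>Since e \<le> 1, all remainders can be collected as multiples of e^3.\<close>
  have p: "e ^ 6 \<le> e ^ 3" "e * e ^ 3 \<le> e ^ 3" "e * e \<le> e" "e ^ 3 \<le> e * e" "e * (e * e) = e ^ 3"
    using e power_decreasing[of 3 6 e] power_decreasing[of 2 3 e]
    by (simp_all add: mult_left_le_one_le power2_eq_square power3_eq_cube)
  have "cmod k \<le> e ^ 6 + e * (C * e ^ 3) + e * (C * e ^ 3)"
  proof -
    have "cmod (cinner (K v) v) \<le> e ^ 6" using d by (simp add: power_mult[symmetric])
    moreover have "cmod (E * cinner (K v) y) \<le> e * (C * e ^ 3)"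
      unfolding norm_mult nE C_def using e by (intro mult_left_mono first_order_left[OF v e3 d y]) auto
    moreover have "cmod (E * cinner (K x) v) \<le> e * (C * e ^ 3)"
      unfolding norm_mult nE C_def using e by (intro mult_left_mono first_order_right[OF v e3 d x]) auto
    ultimately show ?thesis unfolding k_def
      using norm_triangle_ineq[of "cinner (K v) v + E * cinner (K v) y" "E * cinner (K x) v"]
        norm_triangle_ineq[of "cinner (K v) v" "E * cinner (K v) y"] by linarith
  qed
  also have "\<dots> \<le> (1 + 2 * C) * e ^ 3"
    using p(1) mult_left_mono[OF p(2) C] by (simp add: algebra_simps)
  finally have k: "cmod k \<le> (1 + 2 * C) * e ^ 3" .
  have eeK: "cmod (E * E * cinner (K x) y) \<le> e * e * M"
    unfolding norm_mult nE using form_le[OF x y] e by (intro mult_left_mono) auto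
  have "(1 + 2 * C) * e ^ 3 \<le> (1 + 2 * C) * (e * e)"
    using p(4) C by (intro mult_left_mono) auto
  then have kk: "cmod (cinner (K a) b) \<le> (1 + 2 * C + M) * (e * e)"
    unfolding 1 using norm_triangle_ineq[of k "E * E * cinner (K x) y"] k eeK by (simp add: algebra_simps)
  have z: "cmod (cinner a b - 1) \<le> 3 * e"
  proof -
    have "cmod (E * cinner v y) \<le> e" "cmod (E * cinner x v) \<le> e"
      unfolding norm_mult nE using cmod_cinner_le_1[of v y] cmod_cinner_le_1[of x v] v x y e
      by (auto simp: mult_left_le)
    moreover have "cmod (E * E * cinner x y) \<le> e"
      unfolding norm_mult nE using cmod_cinner_le_1[of x y] x y e p(3)
      by (meson mult_left_le mult_nonneg_nonneg less_imp_le order_trans)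
    ultimately show ?thesis unfolding 2
      using norm_triangle_ineq[of "E * cinner v y + E * cinner x v" "E * E * cinner x y"]
        norm_triangle_ineq[of "E * cinner v y" "E * cinner x v"] by linarith
  qed
  have yx: "(norm (y - x))\<^sup>2 \<le> 4"
  proof -
    have "norm (y - x) \<le> 2" using norm_triangle_ineq4[of y x] x y by linarith
    then show ?thesis using power_mono[of "norm (y - x)" 2 2] by simp
  qed
  have "4 * Re (cinner (K a) b) \<le> (1 + 3 * e) * (e\<^sup>2 * (norm (y - x))\<^sup>2)
      + 4 * ((1 + 2 * C + M) * (e * e) * (3 * e))"
  proof -
    have "(1 + cmod (cinner a b - 1)) * (norm (b - a))\<^sup>2 \<le> (1 + 3 * e) * (e\<^sup>2 * (norm (y - x))\<^sup>2)"
      unfolding 3 using z by (intro mult_right_mono) auto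
    moreover have "cmod (cinner (K a) b) * cmod (cinner a b - 1) \<le> (1 + 2 * C + M) * (e * e) * (3 * e)"
      using kk z C M(1) by (intro mult_mono) auto
    ultimately show ?thesis using second_order[of a b] by linarith
  qed
  moreover have "Re (cinner (K a) b) = Re k + e * e * Re (cinner (K x) y)"
    unfolding 1 by (simp add: E_def)
  moreover have "- Re k \<le> (1 + 2 * C) * e ^ 3" using abs_Re_le_cmod[of k] k by linarith
  \<comment> \<open>The bound ||y - x||^2 \<le> 4 turns the factor 3 e into the cubic error 12
    e^3.\<close>
  moreover have "(1 + 3 * e) * (e\<^sup>2 * (norm (y - x))\<^sup>2) \<le> e * e * (norm (y - x))\<^sup>2 + 12 * e ^ 3"
    using mult_left_mono[OF yx, of "3 * e ^ 3"] e by (simp add: power2_eq_square power3_eq_cube algebra_simps)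
  ultimately have "4 * (e * e * Re (cinner (K x) y)) \<le> e * e * (norm (y - x))\<^sup>2 + 12 * e ^ 3
      + 4 * ((1 + 2 * C + M) * (e * e) * (3 * e)) + 4 * ((1 + 2 * C) * e ^ 3)"
    by linarith
  also have "\<dots> = e * e * ((norm (y - x))\<^sup>2 + (12 + 12 * (1 + 2 * C + M) + 4 * (1 + 2 * C)) * e)"
    by (simp add: power3_eq_cube algebra_simps)
  finally have "e * e * (4 * Re (cinner (K x) y)) \<le> \<dots>" by simp
  then have "4 * Re (cinner (K x) y) \<le> (norm (y - x))\<^sup>2 + (12 + 12 * (1 + 2 * C + M) + 4 * (1 + 2 * C)) * e"
    using e by (subst (asm) mult_le_cancel_left_pos) auto
  \<comment> \<open>With C = 4 + M the coefficient of e is 156 + 44 M, rounded up here.\<close>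
  also have "\<dots> \<le> (norm (y - x))\<^sup>2 + (160 + 100 * M) * e"
    using M(1) e by (intro add_left_mono mult_right_mono) (auto simp: C_def)
  finally show ?thesis .
qed

section \<open>Limit along unit vectors on which the form of K tends to 0\<close>

context
  assumes attain: "\<And>\<epsilon>. 0 < \<epsilon> \<Longrightarrow> \<exists>v. norm v = 1 \<and> cmod (cinner (K v) v) \<le> \<epsilon>"
begin

lemma second_order_limit_unit:
  assumes x: "norm x \<le> 1" and y: "norm y \<le> 1"
  shows "4 * Re (cinner (K x) y) \<le> (norm (y - x))\<^sup>2"
proof (rule field_le_epsilon)
  fix h :: real assume h: "0 < h"
  \<comment> \<open>Chosen so that the remainder of \<open>second_order_limit_aux\<close> is at most
    h.\<close>
  define e where "e = min 1 (h / (160 + 100 * M))"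
  have e: "0 < e" "e \<le> 1" using h M(1) by (auto simp: e_def)
  have "(160 + 100 * M) * e \<le> (160 + 100 * M) * (h / (160 + 100 * M))"
    using M(1) by (intro mult_left_mono) (auto simp: e_def)
  also have "\<dots> = h" using M(1) by simp
  finally have eh: "(160 + 100 * M) * e \<le> h" .
  obtain v where "norm v = 1" "cmod (cinner (K v) v) \<le> (e ^ 3)\<^sup>2"
    using attain[of "(e ^ 3)\<^sup>2"] e by auto
  from second_order_limit_aux[OF this(1) e this(2) x y] eh
  show "4 * Re (cinner (K x) y) \<le> (norm (y - x))\<^sup>2 + h" by linarith
qed

text \<open>Both sides scale by s^2 under a common positive factor s, so the restriction to the unit
  ball can be removed.\<close>

lemma second_order_limit: "4 * Re (cinner (K x) y) \<le> (norm (y - x))\<^sup>2"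
proof -
  define s where "s = inverse (1 + norm x + norm y)"
  have d: "0 < 1 + norm x + norm y" using norm_ge_zero[of x] norm_ge_zero[of y] by linarith
  have s: "0 < s" using d by (simp add: s_def)
  have "norm (of_real s *\<^sub>C x) \<le> 1" "norm (of_real s *\<^sub>C y) \<le> 1"
    using s d by (simp_all add: norm_scaleC) (simp_all add: s_def field_simps)
  from second_order_limit_unit[OF this]
  have "(s * s) * (4 * Re (cinner (K x) y)) \<le> (s * s) * (norm (y - x))\<^sup>2"
    using s by (simp add: bounded_clinearD[OF K] cinner_scaleC_left cinner_scaleC_right
        scaleC_diff_right[symmetric] norm_scaleC power_mult_distrib power2_eq_square mult_ac)
  then show ?thesis using s by (subst (asm) mult_le_cancel_left_pos) auto
qed

text \<open>Take y = w = 2 K x + x in \<open>second_order_limit\<close>. Since 2 K x = w - x, it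
  reads 2 Re (w - x, w) \<le> ||w - x||^2, which is equivalent to ||w|| \<le> ||x||.\<close>

lemma contraction_bound: "norm (2 *\<^sub>C K x + x) \<le> norm x"
proof -
  define w where "w = 2 *\<^sub>C K x + x"
  have "4 * Re (cinner (K x) w) \<le> (norm w)\<^sup>2 - 2 * Re (cinner w x) + (norm x)\<^sup>2"
    using second_order_limit[of x w] by (simp add: norm_diff_sq)
  moreover have "Re (cinner w w) = 2 * Re (cinner (K x) w) + Re (cinner x w)"
    by (subst w_def) (simp add: cinner_add_left cinner_scaleC_left)
  moreover have "Re (cinner w x) = Re (cinner x w)" by (subst cinner_commute) simp
  ultimately have "(norm w)\<^sup>2 \<le> (norm x)\<^sup>2" by (simp add: Re_cinner_self)
  then show ?thesis unfolding w_def by (rule power2_le_imp_le) simp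
qed

text \<open>A lower bound for K contradicts \<open>first_order_left\<close>, by which K v becomes
  arbitrarily small on unit vectors. This later puts 1 into the spectrum of L.\<close>

lemma not_invertible: "\<not> op_invertible K"
proof
  assume "op_invertible K"
  then obtain c where c: "c > 0" "\<And>x. c * norm x \<le> norm (K x)"
    using op_invertible_bounded_below by blast
  \<comment> \<open>Testing with K v / M gives ||K v||^2 \<le> M (4 + M) e; this e brings the right
    side down to c^2 / 2.\<close>
  define e where "e = min 1 (c\<^sup>2 / (2 * (M * (4 + M))))"
  have e: "0 < e" "e \<le> 1" using c M(1) by (auto simp: e_def)
  obtain v where v: "norm v = 1" "cmod (cinner (K v) v) \<le> e\<^sup>2" using attain[of "e\<^sup>2"] e by auto
  have cv: "c \<le> norm (K v)" using c(2)[of v] v by simp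
  define x where "x = of_real (inverse M) *\<^sub>C K v"
  have "norm x \<le> 1" using M(1) M(2)[of v] v
    by (simp add: x_def norm_scaleC norm_inverse norm_divide field_simps)
  from first_order_left[OF v(1) e v(2) this]
  have "(norm (K v))\<^sup>2 / M \<le> (4 + M) * e"
    using M(1) by (simp add: x_def cinner_scaleC_right cinner_self norm_divide norm_mult norm_inverse
        norm_power divide_inverse mult.commute)
  then have "(norm (K v))\<^sup>2 \<le> M * ((4 + M) * e)" using M(1) by (simp add: field_simps)
  also have "\<dots> \<le> M * ((4 + M) * (c\<^sup>2 / (2 * (M * (4 + M)))))"
    using M(1) by (intro mult_left_mono) (auto simp: e_def)
  also have "\<dots> = (M * (4 + M)) * (c\<^sup>2 / (2 * (M * (4 + M))))" by (simp only: mult.assoc)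
  also have "\<dots> = c\<^sup>2 / 2"
  proof -
    have cancel: "N * (c\<^sup>2 / (2 * N)) = c\<^sup>2 / 2" if "N \<noteq> 0" for N using that by simp
    show ?thesis by (rule cancel) (use M(1) in simp)
  qed
  finally have "(norm (K v))\<^sup>2 \<le> c\<^sup>2 / 2" .
  moreover have "c\<^sup>2 \<le> (norm (K v))\<^sup>2" using cv c(1) by (intro power_mono) auto
  moreover have "c\<^sup>2 > 0" using c(1) by simp
  ultimately show False by linarith
qed

end

end

text \<open>Division by a point \<mu> of largest modulus in the closed numerical range normalises A,
  so that K = A / \<mu> - I meets the locale assumptions and its form approaches 0 on unit
  vectors.\<close>

lemma rank_one_condition_imp_contraction:
  fixes A :: "'a::complex_hilbert_space \<Rightarrow> 'a"
  assumes A: "bounded_clinear A" and A0: "A x0 \<noteq> 0"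
    and b: "\<And>B. bounded_clinear B \<Longrightarrow> rank_one B \<Longrightarrow>
      op_spectral_radius (A \<circ> B) \<le> numerical_radius A * numerical_radius B"
  shows "\<exists>\<mu> L. contraction L \<and> 1 \<in> op_spectrum L \<and> A = (\<lambda>x. (\<mu> / 2) *\<^sub>C (x + L x))"
proof -
  have x0: "x0 \<noteq> 0" using A0 bounded_clinearD(5)[OF A] by auto
  let ?r = "numerical_radius A" and ?W = "numerical_range A"
  note form = rank_one_condition_form_bound[OF A b x0]
  have r: "0 < ?r"
  proof -
    have "?r \<noteq> 0"
    proof
      assume "?r = 0"
      \<comment> \<open>The pair v = x0, u = A x0 detects A x0 itself.\<close>
      then have "cinner (A x0) (A x0) = 0" using form[of x0 "A x0"] by simp
      then show False using A0 by (simp add: cinner_self)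
    qed
    then show ?thesis using numerical_radius_nonneg[OF A x0] by simp
  qed
  have "bounded ?W"
    using numerical_range_bdd_above[OF A] by (auto simp: bounded_iff bdd_above_def)
  \<comment> \<open>The numerical range may fail to be closed in infinite dimension, hence the
    closure and the merely approximate attainment below.\<close>
  then have "compact (closure ?W)" by simp
  moreover obtain u :: 'a where u: "norm u = 1" using unit_vector_exists[OF x0] .
  then have "closure ?W \<noteq> {}" by (auto simp: numerical_range_eq)
  ultimately obtain \<mu> where \<mu>: "\<mu> \<in> closure ?W" "\<And>z. z \<in> closure ?W \<Longrightarrow> cmod z \<le> cmod \<mu>"
    using continuous_attains_sup[of "closure ?W" cmod] continuous_on_norm_id by blast
  have r\<mu>: "?r \<le> cmod \<mu>"
  proof (rule numerical_radius_leI[OF x0])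
    fix x :: 'a assume "norm x = 1"
    then have "cinner (A x) x \<in> closure ?W" by (intro closure_subset[THEN subsetD]) (auto simp: numerical_range_eq)
    then show "cmod (cinner (A x) x) \<le> cmod \<mu>" by (rule \<mu>)
  qed
  have m: "\<mu> \<noteq> 0" using r r\<mu> by auto
  define K where "K x = (1 / \<mu>) *\<^sub>C A x - x" for x
  have K: "bounded_clinear K" unfolding K_def
    by (intro bounded_clinear_diff bounded_clinear_scaleC_comp A bounded_clinear_ident)
  obtain M where M: "0 < M" "\<And>x. norm (K x) \<le> M * norm x" using bounded_clinear_boundE[OF K] by metis
  interpret rank_one_condition K M
  proof
    fix u v
    have "cmod \<mu> * (2 * cmod (cinner (K v) u + cinner v u)) = 2 * cmod (cinner (A v) u)"
      using m by (simp add: K_def cinner_diff_left cinner_scaleC_left norm_divide)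
    also have "\<dots> \<le> ?r * (norm u * norm v + cmod (cinner v u))" by (rule form)
    also have "\<dots> \<le> cmod \<mu> * (norm u * norm v + cmod (cinner v u))"
      using r\<mu> by (intro mult_right_mono) auto
    finally show "2 * cmod (cinner (K v) u + cinner v u) \<le> norm u * norm v + cmod (cinner v u)"
      using m by simp
  qed (fact K M)+
  have attain: "\<exists>v. norm v = 1 \<and> cmod (cinner (K v) v) \<le> \<epsilon>" if \<epsilon>: "0 < \<epsilon>" for \<epsilon>
  proof -
    \<comment> \<open>The tolerance carries the factor |\<mu>| because the form of K divides by
      \<mu>.\<close>
    have "0 < cmod \<mu> * \<epsilon>" using \<epsilon> m by simp
    then obtain z where "z \<in> ?W" "dist z \<mu> < cmod \<mu> * \<epsilon>"
      using \<mu>(1) by (meson closure_approachable)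
    then obtain v where v: "norm v = 1" "cmod (cinner (A v) v - \<mu>) \<le> cmod \<mu> * \<epsilon>"
      by (auto simp: numerical_range_eq dist_norm)
    have "cinner (K v) v = (cinner (A v) v - \<mu>) / \<mu>"
      using v m by (simp add: K_def cinner_diff_left cinner_scaleC_left cinner_self diff_divide_distrib)
    then have "cmod (cinner (K v) v) = cmod (cinner (A v) v - \<mu>) / cmod \<mu>"
      by (simp only: norm_divide)
    then have "cmod (cinner (K v) v) \<le> \<epsilon>"
      using v(2) m by (simp add: divide_le_eq mult.commute)
    then show ?thesis using v by blast
  qed
  define L where "L x = 2 *\<^sub>C K x + x" for x
  have "bounded_clinear L" unfolding L_def
    by (intro bounded_clinear_add bounded_clinear_scaleC_comp K bounded_clinear_ident)
  then have "contraction L" using contraction_bound[OF attain] by (simp add: contraction_iff L_def)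
  moreover have "1 \<in> op_spectrum L"
    using not_invertible[OF attain] op_invertible_scaleC_comp[of 2 K] by (simp add: op_spectrum_iff L_def)
  moreover have "A x = (\<mu> / 2) *\<^sub>C (x + L x)" for x
  proof -
    have "2 *\<^sub>C x = x + x" using scaleC_add_left[of 1 1 x] by simp
    then have "x + L x = (2 / \<mu>) *\<^sub>C A x"
      by (simp add: L_def K_def scaleC_diff_right scaleC_scaleC)
    then show ?thesis using m by (simp add: scaleC_scaleC)
  qed
  ultimately show ?thesis by blast
qed

section \<open>Euclidean vectors and orthonormal families\<close>

unbundle no vec_syntax
unbundle no inner_syntax

section \<open>Euclidean vectors and the matrix operator norm\<close>

lemma cscalar_prod_sum: "v \<bullet>c w = (\<Sum>i<dim_vec w. v $ i * cnj (w $ i))"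
  by (simp add: scalar_prod_def lessThan_atLeast0)

lemma euclidean_norm_sum: "euclidean_norm v = sqrt (\<Sum>i<dim_vec v. (cmod (v $ i))\<^sup>2)"
proof -
  have "Re (z * cnj z) = (cmod z)\<^sup>2" for z
    using complex_norm_square[of z, symmetric] by (simp del: of_real_power)
  then show ?thesis by (simp only: euclidean_norm_def cscalar_prod_sum Re_sum)
qed

lemma euclidean_norm_nonneg [simp]: "0 \<le> euclidean_norm v"
  by (simp add: euclidean_norm_sum sum_nonneg)

lemma euclidean_norm_sq: "(euclidean_norm v)\<^sup>2 = (\<Sum>i<dim_vec v. (cmod (v $ i))\<^sup>2)"
  by (simp add: euclidean_norm_sum sum_nonneg)

lemma cscalar_prod_self: "v \<bullet>c v = complex_of_real ((euclidean_norm v)\<^sup>2)"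
  by (simp only: cscalar_prod_sum euclidean_norm_sq of_real_sum complex_norm_square)

lemma euclidean_norm_eq_0:
  assumes "v \<in> carrier_vec m"
  shows "euclidean_norm v = 0 \<longleftrightarrow> v = 0\<^sub>v m"
proof
  assume "euclidean_norm v = 0"
  then have "(\<Sum>i<dim_vec v. (cmod (v $ i))\<^sup>2) = 0" using euclidean_norm_sq[of v] by simp
  then have "\<forall>i<m. v $ i = 0" using assms by (subst (asm) sum_nonneg_eq_0_iff) auto
  then show "v = 0\<^sub>v m" using assms by auto
qed (simp add: euclidean_norm_sum)

lemma euclidean_norm_smult: "euclidean_norm (c \<cdot>\<^sub>v v) = cmod c * euclidean_norm v"
  by (simp add: euclidean_norm_sum norm_mult power_mult_distrib sum_distrib_left[symmetric] real_sqrt_mult)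

lemma euclidean_norm_append:
  "(euclidean_norm (v @\<^sub>v w))\<^sup>2 = (euclidean_norm v)\<^sup>2 + (euclidean_norm w)\<^sup>2"
proof -
  have split: "(\<Sum>i<a + b. h i) = (\<Sum>i<a. h i) + (\<Sum>i<b. h (a + i))" for a b and h :: "nat \<Rightarrow> real"
    by (induction b) (simp_all add: add.assoc)
  show ?thesis by (simp add: euclidean_norm_sq split)
qed

lemma euclidean_norm_diff_sq:
  assumes "v \<in> carrier_vec m" "w \<in> carrier_vec m"
  shows "(euclidean_norm (v - w))\<^sup>2 = (euclidean_norm v)\<^sup>2 - 2 * Re (v \<bullet>c w) + (euclidean_norm w)\<^sup>2"
proof -
  have c: "(cmod (a - b))\<^sup>2 = (cmod a)\<^sup>2 - 2 * Re (a * cnj b) + (cmod b)\<^sup>2" for a b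
    unfolding cmod_power2 by (simp add: power2_eq_square algebra_simps)
  have d: "dim_vec v = m" "dim_vec w = m" using assms by auto
  show ?thesis
    using d by (simp add: euclidean_norm_sq cscalar_prod_sum c sum.distrib sum_subtractf sum_distrib_left
        del: times_complex.sel)
qed

lemma cmod_vec_le_euclidean_norm:
  assumes "i < dim_vec v"
  shows "cmod (v $ i) \<le> euclidean_norm v"
proof -
  have "(cmod (v $ i))\<^sup>2 \<le> (euclidean_norm v)\<^sup>2"
    unfolding euclidean_norm_sq using assms by (intro member_le_sum) auto
  then show ?thesis by (rule power2_le_imp_le) simp
qed

text \<open>The supremum in \<open>mat_opnorm\<close> must first be shown to be bounded: on the unit
  ball each coordinate of M v is at most the absolute row sum. Normalisation then passes from the
  ball to all vectors.\<close>

lemma mat_opnorm_le_iff: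
  assumes M: "M \<in> carrier_mat m m" and k: "0 \<le> k"
  shows "mat_opnorm M \<le> k \<longleftrightarrow> (\<forall>v\<in>carrier_vec m. euclidean_norm (M *\<^sub>v v) \<le> k * euclidean_norm v)"
    (is "_ \<longleftrightarrow> ?r")
proof
  let ?S = "{euclidean_norm (M *\<^sub>v v) | v. v \<in> carrier_vec (dim_col M) \<and> euclidean_norm v \<le> 1}"
  have bdd: "bdd_above ?S"
  proof (rule bdd_aboveI)
    fix s assume "s \<in> ?S"
    then obtain v where v: "s = euclidean_norm (M *\<^sub>v v)" "v \<in> carrier_vec m" "euclidean_norm v \<le> 1"
      using M by auto
    have "cmod ((M *\<^sub>v v) $ i) \<le> (\<Sum>j<m. cmod (M $$ (i, j)))" if "i < m" for i
    proof -
      have "(M *\<^sub>v v) $ i = (\<Sum>j<m. M $$ (i, j) * v $ j)"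
        using M v that by (simp add: scalar_prod_def lessThan_atLeast0)
      also have "cmod \<dots> \<le> (\<Sum>j<m. cmod (M $$ (i, j)))"
      proof (rule sum_norm_le)
        fix j assume "j \<in> {..<m}"
        then have "cmod (v $ j) \<le> 1" using cmod_vec_le_euclidean_norm[of j v] v by auto
        then show "cmod (M $$ (i, j) * v $ j) \<le> cmod (M $$ (i, j))"
          by (simp add: norm_mult mult_left_le)
      qed
      finally show ?thesis .
    qed
    then have "(\<Sum>i<m. (cmod ((M *\<^sub>v v) $ i))\<^sup>2) \<le> (\<Sum>i<m. (\<Sum>j<m. cmod (M $$ (i, j)))\<^sup>2)"
      by (intro sum_mono power_mono) auto
    then show "s \<le> sqrt (\<Sum>i<m. (\<Sum>j<m. cmod (M $$ (i, j)))\<^sup>2)"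
      using M by (simp add: v(1) euclidean_norm_sum)
  qed
  have dM: "dim_col M = m" using M by simp
  show ?r if le: "mat_opnorm M \<le> k"
  proof
    fix v :: "complex Matrix.vec" assume v: "v \<in> carrier_vec m"
    show "euclidean_norm (M *\<^sub>v v) \<le> k * euclidean_norm v"
    proof (cases "euclidean_norm v = 0")
      case True
      then show ?thesis using M v by (simp add: euclidean_norm_eq_0[OF v])
        (simp add: euclidean_norm_sum scalar_prod_def)
    next
      case False
      let ?c = "complex_of_real (inverse (euclidean_norm v))"
      have "euclidean_norm (?c \<cdot>\<^sub>v v) = 1"
        using False by (simp add: euclidean_norm_smult norm_inverse)
      then have "euclidean_norm (M *\<^sub>v (?c \<cdot>\<^sub>v v)) \<in> ?S" using v dM by force
      then have "euclidean_norm (M *\<^sub>v (?c \<cdot>\<^sub>v v)) \<le> mat_opnorm M"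
        unfolding mat_opnorm_def by (rule cSup_upper[OF _ bdd])
      then have "inverse (euclidean_norm v) * euclidean_norm (M *\<^sub>v v) \<le> k"
        using le by (simp add: mult_mat_vec[OF M v] euclidean_norm_smult norm_inverse)
      moreover have "0 < euclidean_norm v" using False euclidean_norm_nonneg[of v] by linarith
      ultimately show ?thesis by (simp add: field_simps)
    qed
  qed
  show "mat_opnorm M \<le> k" if r: ?r
    unfolding mat_opnorm_def
  proof (rule cSup_least)
    \<comment> \<open>The zero vector shows nonemptiness also for m = 0, the case of a vacuous
      block.\<close>
    have "euclidean_norm (M *\<^sub>v 0\<^sub>v m) \<in> ?S" using dM by (auto simp: euclidean_norm_sum)
    then show "?S \<noteq> {}" by blast
    fix s assume "s \<in> ?S"
    then obtain v where v: "s = euclidean_norm (M *\<^sub>v v)" "v \<in> carrier_vec m" "euclidean_norm v \<le> 1"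
      using dM by auto
    then have "s \<le> k * euclidean_norm v" using r by auto
    also have "\<dots> \<le> k" using v(3) k by (simp add: mult_left_le)
    finally show "s \<le> k" .
  qed
qed

lemma sub_half_mult_vec:
  assumes "C \<in> carrier_mat m m" "v \<in> carrier_vec m"
  shows "(C - (1 / 2) \<cdot>\<^sub>m 1\<^sub>m m) *\<^sub>v v = C *\<^sub>v v - (1 / 2) \<cdot>\<^sub>v (v :: complex Matrix.vec)"
proof -
  have "((1 / 2) \<cdot>\<^sub>m 1\<^sub>m m) *\<^sub>v v = (1 / 2) \<cdot>\<^sub>v v"
    using assms(2) by (intro eq_vecI) auto
  then show ?thesis using assms minus_mult_distrib_mat_vec[of C m m "(1 / 2) \<cdot>\<^sub>m 1\<^sub>m m" v] by simp
qed

text \<open>Complete the square: ||C v - v/2||^2 = ||C v||^2 - Re (C v, v) + ||v/2||^2.\<close>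

lemma opnorm_half_iff:
  assumes C: "C \<in> carrier_mat m m"
  shows "mat_opnorm (C - (1 / 2) \<cdot>\<^sub>m 1\<^sub>m m) \<le> 1 / 2 \<longleftrightarrow>
    (\<forall>v\<in>carrier_vec m. (euclidean_norm (C *\<^sub>v v))\<^sup>2 \<le> Re ((C *\<^sub>v v) \<bullet>c v))"
proof -
  have "euclidean_norm ((C - (1 / 2) \<cdot>\<^sub>m 1\<^sub>m m) *\<^sub>v v) \<le> 1 / 2 * euclidean_norm v
      \<longleftrightarrow> (euclidean_norm (C *\<^sub>v v))\<^sup>2 \<le> Re ((C *\<^sub>v v) \<bullet>c v)"
    if v: "v \<in> carrier_vec m" for v
  proof -
    have Cv: "C *\<^sub>v v \<in> carrier_vec m" using C v by simp
    have "euclidean_norm (C *\<^sub>v v - (1 / 2) \<cdot>\<^sub>v v) \<le> 1 / 2 * euclidean_norm v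
        \<longleftrightarrow> (euclidean_norm (C *\<^sub>v v - (1 / 2) \<cdot>\<^sub>v v))\<^sup>2 \<le> (1 / 2 * euclidean_norm v)\<^sup>2"
      by (subst abs_le_square_iff[symmetric]) simp
    also have "(C *\<^sub>v v) \<bullet>c ((1 / 2) \<cdot>\<^sub>v v) = (C *\<^sub>v v) \<bullet>c v / 2"
      using v by (simp add: cscalar_prod_sum sum_divide_distrib)
    then have "(euclidean_norm (C *\<^sub>v v - (1 / 2) \<cdot>\<^sub>v v))\<^sup>2
        = (euclidean_norm (C *\<^sub>v v))\<^sup>2 - Re ((C *\<^sub>v v) \<bullet>c v) + (1 / 2 * euclidean_norm v)\<^sup>2"
      using v by (simp only: euclidean_norm_diff_sq[OF Cv smult_carrier_vec[THEN iffD2, OF v]])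
        (simp add: euclidean_norm_smult norm_divide)
    finally show ?thesis unfolding sub_half_mult_vec[OF C v] by simp
  qed
  then show ?thesis using C by (subst mat_opnorm_le_iff[of _ m]) auto
qed

text \<open>Substituting u = C v, v = D u turns ||C v||^2 \<le> Re (C v, v) into ||u||^2 \<le> Re (D
  u, u), and normalising u gives the half-plane condition.\<close>

lemma opnorm_half_iff_numerical_range:
  assumes C: "C \<in> carrier_mat m m" and D: "D \<in> carrier_mat m m"
    and CD: "inverts_mat C D" "inverts_mat D C"
  shows "mat_opnorm (C - (1 / 2) \<cdot>\<^sub>m 1\<^sub>m m) \<le> 1 / 2 \<longleftrightarrow> mat_numerical_range D \<subseteq> {z. Re z \<ge> 1}"
proof -
  have CDv: "C *\<^sub>v (D *\<^sub>v v) = v" "D *\<^sub>v (C *\<^sub>v v) = v" if "v \<in> carrier_vec m" for v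
    using CD C D that unfolding inverts_mat_def
    by (metis assoc_mult_mat_vec carrier_matD(1) one_mult_mat_vec)+
  have Re_comm: "Re (v \<bullet>c w) = Re (w \<bullet>c v)" if "v \<in> carrier_vec m" "w \<in> carrier_vec m" for v w
    using that by (auto simp: cscalar_prod_sum mult.commute intro!: sum.cong)
  have "(\<forall>v\<in>carrier_vec m. (euclidean_norm (C *\<^sub>v v))\<^sup>2 \<le> Re ((C *\<^sub>v v) \<bullet>c v))
      \<longleftrightarrow> (\<forall>u\<in>carrier_vec m. (euclidean_norm u)\<^sup>2 \<le> Re ((D *\<^sub>v u) \<bullet>c u))" (is "?p \<longleftrightarrow> ?q")
  proof
    assume ?p
    then show ?q using CDv D Re_comm by (metis mult_mat_vec_carrier)
  next
    assume ?q
    then show ?p using CDv C Re_comm by (metis mult_mat_vec_carrier)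
  qed
  also have "?q \<longleftrightarrow> mat_numerical_range D \<subseteq> {z. Re z \<ge> 1}"
  proof
    assume q: ?q
    show "mat_numerical_range D \<subseteq> {z. Re z \<ge> 1}"
    proof
      fix z assume "z \<in> mat_numerical_range D"
      then obtain v where v: "z = (D *\<^sub>v v) \<bullet>c v" "v \<in> carrier_vec m" "v \<bullet>c v = 1"
        using D by (auto simp: mat_numerical_range_def)
      then have "(euclidean_norm v)\<^sup>2 = 1" using cscalar_prod_self[of v] by (metis of_real_eq_1_iff)
      then show "z \<in> {z. Re z \<ge> 1}" using q v by auto
    qed
  next
    assume W: "mat_numerical_range D \<subseteq> {z. Re z \<ge> 1}"
    show ?q
    proof
      fix u :: "complex Matrix.vec" assume u: "u \<in> carrier_vec m"
      show "(euclidean_norm u)\<^sup>2 \<le> Re ((D *\<^sub>v u) \<bullet>c u)"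
      proof (cases "euclidean_norm u = 0")
        case True
        then have "u = 0\<^sub>v m" using euclidean_norm_eq_0[OF u] by simp
        then show ?thesis using mult_mat_vec_carrier[OF D u] by (simp add: euclidean_norm_sum)
      next
        case False
        define t where "t = inverse (euclidean_norm u)"
        have "0 < euclidean_norm u" using False euclidean_norm_nonneg[of u] by linarith
        then have t: "t > 0" by (simp add: t_def)
        define v where "v = complex_of_real t \<cdot>\<^sub>v u"
        have "euclidean_norm v = 1" using False by (simp add: v_def t_def euclidean_norm_smult norm_inverse)
        then have "v \<bullet>c v = 1" by (simp add: cscalar_prod_self)
        moreover have v: "v \<in> carrier_vec m" using u by (simp add: v_def)
        ultimately have "Re ((D *\<^sub>v v) \<bullet>c v) \<ge> 1" using W D unfolding mat_numerical_range_def by auto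
        moreover have "(D *\<^sub>v v) \<bullet>c v = complex_of_real (t * t) * ((D *\<^sub>v u) \<bullet>c u)"
          using u D by (simp add: v_def mult_mat_vec[OF D u] cscalar_prod_sum sum_distrib_left mult_ac)
        ultimately have "1 \<le> t * t * Re ((D *\<^sub>v u) \<bullet>c u)" by simp
        then show ?thesis using False t by (simp add: t_def field_simps power2_eq_square)
      qed
    qed
  qed
  finally show ?thesis unfolding opnorm_half_iff[OF C] .
qed

section \<open>Orthonormal families and bases\<close>

lemma orthonormalD:
  "orthonormal n e \<Longrightarrow> i < n \<Longrightarrow> j < n \<Longrightarrow> cinner (e i) (e j) = (if i = j then 1 else 0)"
  by (simp add: orthonormal_def)

lemma orthonormal_cinner_sum:
  assumes "orthonormal n e" "j < n"
  shows "cinner (\<Sum>i<n. c i *\<^sub>C e i) (e j) = c j"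
proof -
  have "cinner (\<Sum>i<n. c i *\<^sub>C e i) (e j) = (\<Sum>i<n. if i = j then c i else 0)"
    unfolding cinner_sum_left cinner_scaleC_left
    by (rule sum.cong) (use assms in \<open>auto simp: orthonormalD\<close>)
  also have "\<dots> = c j" using assms(2) by simp
  finally show ?thesis .
qed

lemma orthonormal_norm_sum:
  assumes "orthonormal n e"
  shows "(norm (\<Sum>i<n. c i *\<^sub>C e i))\<^sup>2 = (\<Sum>i<n. (cmod (c i))\<^sup>2)"
proof -
  have "complex_of_real ((norm (\<Sum>i<n. c i *\<^sub>C e i))\<^sup>2) = (\<Sum>j<n. cnj (c j) * cinner (\<Sum>i<n. c i *\<^sub>C e i) (e j))"
    unfolding cinner_self[symmetric] by (simp only: cinner_sum_right cinner_scaleC_right)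
  also have "\<dots> = complex_of_real (\<Sum>j<n. (cmod (c j))\<^sup>2)"
    unfolding of_real_sum complex_norm_square
    by (rule sum.cong) (simp_all add: orthonormal_cinner_sum[OF assms] mult.commute)
  finally show ?thesis by (simp only: of_real_eq_iff)
qed

lemma bessel:
  assumes e: "orthonormal n e"
  shows "(\<Sum>i<n. (cmod (cinner x (e i)))\<^sup>2) \<le> (norm x)\<^sup>2"
proof -
  define s where "s = (\<Sum>i<n. cinner x (e i) *\<^sub>C e i)"
  have "cinner x s = (\<Sum>i<n. complex_of_real ((cmod (cinner x (e i)))\<^sup>2))"
    unfolding s_def cinner_sum_right cinner_scaleC_right complex_norm_square
    by (simp add: mult.commute)
  then have "Re (cinner x s) = (\<Sum>i<n. (cmod (cinner x (e i)))\<^sup>2)" by (simp add: Re_sum del: of_real_power)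
  moreover have "(norm s)\<^sup>2 = (\<Sum>i<n. (cmod (cinner x (e i)))\<^sup>2)"
    unfolding s_def by (rule orthonormal_norm_sum[OF e])
  ultimately show ?thesis using norm_diff_sq[of x s] zero_le_power2[of "norm (x - s)"] by linarith
qed

text \<open>The remainder is orthogonal to a spanning family, hence to itself.\<close>

lemma orthonormal_basis_expand:
  assumes "orthonormal_basis n e"
  shows "x = (\<Sum>i<n. cinner x (e i) *\<^sub>C e i)"
proof -
  have e: "orthonormal n e" and sp: "cspan (e ` {..<n}) = UNIV"
    using assms by (auto simp: orthonormal_basis_def)
  define r where "r = x - (\<Sum>i<n. cinner x (e i) *\<^sub>C e i)"
  have "cinner (e j) r = 0" if "j < n" for j
    using orthonormal_cinner_sum[OF e that] 
    by (subst cinner_eq_zero_commute) (simp add: r_def cinner_diff_left)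
  then have perp: "cinner y r = 0" if "y \<in> e ` {..<n}" for y using that by auto
  have "cinner y r = 0" if "y \<in> cspan (e ` {..<n})" for y
    using that by (induction rule: complex_vector.span_induct_alt)
      (simp_all add: cinner_add_left cinner_scaleC_left perp)
  then have "cinner r r = 0" using sp by blast
  then show ?thesis by (simp add: cinner_self r_def)
qed

lemma orthonormal_basisI:
  assumes e: "orthonormal n e" and "\<And>x. (\<And>i. i < n \<Longrightarrow> cinner x (e i) = 0) \<Longrightarrow> x = 0"
  shows "orthonormal_basis n e"
proof -
  have "x \<in> cspan (e ` {..<n})" for x
  proof -
    have "x - (\<Sum>i<n. cinner x (e i) *\<^sub>C e i) = 0"
      by (rule assms(2)) (simp add: cinner_diff_left orthonormal_cinner_sum[OF e])
    then have "x = (\<Sum>i<n. cinner x (e i) *\<^sub>C e i)" by simp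
    also have "\<dots> \<in> cspan (e ` {..<n})"
      by (intro complex_vector.span_sum complex_vector.span_scale complex_vector.span_base) auto
    finally show ?thesis .
  qed
  then show ?thesis using e by (auto simp: orthonormal_basis_def)
qed

text \<open>Double counting of |(g j, e i)|^2: Parseval in the basis \<open>e\<close> gives the
  total m, and Bessel for \<open>g\<close> bounds it by n.\<close>

lemma orthonormal_le_basis:
  fixes e g :: "nat \<Rightarrow> 'a::complex_hilbert_space"
  assumes e: "orthonormal_basis n e" and g: "orthonormal m g"
  shows "m \<le> n"
proof -
  have "real m = (\<Sum>j<m. (norm (g j))\<^sup>2)"
  proof -
    have "(norm (g j))\<^sup>2 = 1" if "j < m" for j
      using orthonormalD[OF g that that] Re_cinner_self[of "g j"] by simp
    then show ?thesis by simp
  qed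
  also have "\<dots> = (\<Sum>j<m. \<Sum>i<n. (cmod (cinner (g j) (e i)))\<^sup>2)"
  proof (rule sum.cong)
    fix j
    show "(norm (g j))\<^sup>2 = (\<Sum>i<n. (cmod (cinner (g j) (e i)))\<^sup>2)"
      using e orthonormal_norm_sum[of n e "\<lambda>i. cinner (g j) (e i)"] orthonormal_basis_expand[OF e, of "g j"]
      by (simp add: orthonormal_basis_def)
  qed simp
  also have "\<dots> = (\<Sum>i<n. \<Sum>j<m. (cmod (cinner (e i) (g j)))\<^sup>2)"
    by (subst sum.swap) (simp add: cmod_cinner_commute)
  also have "\<dots> \<le> (\<Sum>i<n. (norm (e i))\<^sup>2)" by (intro sum_mono bessel[OF g])
  also have "\<dots> = real n"
  proof -
    have "(norm (e j))\<^sup>2 = 1" if "j < n" for j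
      using e orthonormalD[of n e j j] that Re_cinner_self[of "e j"] by (simp add: orthonormal_basis_def)
    then show ?thesis by simp
  qed
  finally show ?thesis by simp
qed

lemma orthonormal_append_normalized:
  assumes f: "orthonormal k f" and x: "x \<noteq> 0" "\<And>i. i < k \<Longrightarrow> cinner x (f i) = 0"
  shows "orthonormal (Suc k) (f(k := of_real (inverse (norm x)) *\<^sub>C x))"
proof -
  define u where "u = of_real (inverse (norm x)) *\<^sub>C x"
  have "norm u = 1" using x(1) by (simp add: u_def norm_scaleC norm_inverse)
  then have u: "cinner u u = 1" by (simp add: cinner_self)
  have uf: "cinner u (f i) = 0" if "i < k" for i
    using x(2)[OF that] by (simp add: u_def cinner_scaleC_left)
  then have "cinner (f i) u = 0" if "i < k" for i
    using that cinner_eq_zero_commute[of u] by blast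
  then show ?thesis unfolding u_def[symmetric] using f u uf by (auto simp: orthonormal_def less_Suc_eq)
qed

lemma orthonormal_basis_maximal:
  fixes e g :: "nat \<Rightarrow> 'a::complex_hilbert_space"
  assumes e: "orthonormal_basis n e" and g: "orthonormal n g"
  shows "orthonormal_basis n g"
proof (rule orthonormal_basisI[OF g], rule ccontr)
  fix x assume x: "\<And>i. i < n \<Longrightarrow> cinner x (g i) = 0" "x \<noteq> 0"
  show False
    using orthonormal_le_basis[OF e orthonormal_append_normalized[OF g x(2,1)]] by simp
qed

text \<open>Unit vectors of V orthogonal to the family are adjoined until none remains;
  \<open>orthonormal_le_basis\<close> bounds the length by n, so n - k decreases. Closure of V under
  scalars keeps the normalised vectors in V.\<close>

lemma orthonormal_extend_within:
  fixes e f :: "nat \<Rightarrow> 'a::complex_hilbert_space"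
  assumes e: "orthonormal_basis n e" and f: "orthonormal k f"
    and V: "\<forall>c. \<forall>x\<in>V. c *\<^sub>C x \<in> V"
  shows "\<exists>m g. k \<le> m \<and> (\<forall>i<k. g i = f i) \<and> orthonormal m g \<and> (\<forall>i. k \<le> i \<longrightarrow> i < m \<longrightarrow> g i \<in> V) \<and>
    (\<forall>x\<in>V. (\<forall>i<m. cinner x (g i) = 0) \<longrightarrow> x = 0)"
  using f
proof (induction "n - k" arbitrary: k f rule: less_induct)
  case less
  show ?case
  proof (cases "\<exists>x\<in>V. x \<noteq> 0 \<and> (\<forall>i<k. cinner x (f i) = 0)")
    case False
    then show ?thesis using less.prems by (intro exI[of _ k] exI[of _ f]) auto
  next
    case True
    then obtain x where x: "x \<in> V" "x \<noteq> 0" "\<And>i. i < k \<Longrightarrow> cinner x (f i) = 0" by blast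
    define u where "u = of_real (inverse (norm x)) *\<^sub>C x"
    have uV: "u \<in> V" unfolding u_def using V x(1) by blast
    have o: "orthonormal (Suc k) (f(k := u))"
      unfolding u_def by (rule orthonormal_append_normalized[OF less.prems x(2,3)])
    then have "n - Suc k < n - k" using orthonormal_le_basis[OF e o] by simp
    from less.hyps[OF this o] have "\<exists>m g. Suc k \<le> m \<and> (\<forall>i<Suc k. g i = (f(k := u)) i) \<and> orthonormal m g \<and>
      (\<forall>i. Suc k \<le> i \<longrightarrow> i < m \<longrightarrow> g i \<in> V) \<and> (\<forall>x\<in>V. (\<forall>i<m. cinner x (g i) = 0) \<longrightarrow> x = 0)" .
    then obtain m g where g: "Suc k \<le> m" "\<forall>i<Suc k. g i = (f(k := u)) i"
      "orthonormal m g" "\<forall>i. Suc k \<le> i \<longrightarrow> i < m \<longrightarrow> g i \<in> V"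
      "\<forall>x\<in>V. (\<forall>i<m. cinner x (g i) = 0) \<longrightarrow> x = 0" by (elim exE conjE) (rule that)
    have gf: "g i = f i" if "i < k" for i using g(2)[rule_format, of i] that by simp
    have gk: "g k = u" using g(2)[rule_format, of k] by simp
    have gV: "g i \<in> V" if "k \<le> i" "i < m" for i
      using that g(4)[rule_format, of i] uV gk by (cases "i = k") auto
    show ?thesis
      by (rule exI[of _ m], rule exI[of _ g]) (use Suc_leD[OF g(1)] gf g(3) gV g(5) in \<open>intro conjI allI ballI impI; simp\<close>)
  qed
qed

section \<open>Operators in orthonormal bases\<close>

definition coords :: "nat \<Rightarrow> (nat \<Rightarrow> 'a::complex_hilbert_space) \<Rightarrow> 'a \<Rightarrow> complex Matrix.vec" where
  "coords n e x = Matrix.vec n (\<lambda>i. cinner x (e i))"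

lemma coords_carrier [simp]: "coords n e x \<in> carrier_vec n"
  by (simp add: coords_def)

lemma coords_zero: "coords n e 0 = 0\<^sub>v n"
  by (intro eq_vecI) (simp_all add: coords_def)

lemma euclidean_norm_coords:
  assumes e: "orthonormal_basis n e"
  shows "euclidean_norm (coords n e x) = norm x"
proof -
  have "(euclidean_norm (coords n e x))\<^sup>2 = (norm x)\<^sup>2"
    using e orthonormal_norm_sum[of n e "\<lambda>i. cinner x (e i)"] orthonormal_basis_expand[OF e, of x]
    by (simp add: euclidean_norm_sq coords_def orthonormal_basis_def)
  then show ?thesis by (simp add: power2_eq_iff_nonneg)
qed

lemma coords_inj:
  assumes "orthonormal_basis n e" "coords n e x = coords n e y"
  shows "x = y"
proof -
  have "cinner x (e i) = cinner y (e i)" if "i < n" for i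
    using arg_cong[OF assms(2), of "\<lambda>v. v $ i"] that by (simp add: coords_def)
  then show ?thesis
    using orthonormal_basis_expand[OF assms(1), of x] orthonormal_basis_expand[OF assms(1), of y]
    by simp
qed

lemma coords_sum:
  assumes "orthonormal n e" "v \<in> carrier_vec n"
  shows "coords n e (\<Sum>i<n. v $ i *\<^sub>C e i) = v"
  using assms by (intro eq_vecI) (auto simp: coords_def orthonormal_cinner_sum[OF assms(1)])

text \<open>Separate bases for columns and rows make operator matrices and change-of-basis matrices
  instances of one notion, with one multiplication rule.\<close>

definition mixed_mat :: "nat \<Rightarrow> (nat \<Rightarrow> 'a::complex_hilbert_space) \<Rightarrow> ('a \<Rightarrow> 'a) \<Rightarrow> (nat \<Rightarrow> 'a) \<Rightarrow> complex mat" where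
  "mixed_mat n e A f = Matrix.mat n n (\<lambda>(i, j). cinner (A (f j)) (e i))"

lemma mixed_mat_carrier [simp]: "mixed_mat n e A f \<in> carrier_mat n n"
  by (simp add: mixed_mat_def)

lemma op_mat_eq_mixed_mat: "op_mat n e A = mixed_mat n e A e"
  by (simp add: op_mat_def mixed_mat_def)

lemma cinner_basis_expand:
  assumes A: "bounded_clinear A" and f: "orthonormal_basis n f"
  shows "(\<Sum>k<n. cinner (A (f k)) y * cinner x (f k)) = cinner (A x) y"
proof -
  have "A x = A (\<Sum>k<n. cinner x (f k) *\<^sub>C f k)" using orthonormal_basis_expand[OF f, of x] by simp
  also have "\<dots> = (\<Sum>k<n. cinner x (f k) *\<^sub>C A (f k))" by (simp add: bounded_clinearD[OF A])
  finally show ?thesis by (simp add: cinner_sum_left cinner_scaleC_left mult.commute)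
qed

lemma mixed_mat_mult:
  assumes "bounded_clinear A" "orthonormal_basis n f"
  shows "mixed_mat n e A f * mixed_mat n f B g = mixed_mat n e (\<lambda>x. A (B x)) g"
  by (rule eq_matI)
    (simp_all add: mixed_mat_def scalar_prod_def lessThan_atLeast0[symmetric] cinner_basis_expand[OF assms])

lemma op_mat_mult_coords:
  assumes "bounded_clinear A" "orthonormal_basis n e"
  shows "op_mat n e A *\<^sub>v coords n e x = coords n e (A x)"
  by (rule eq_vecI)
    (simp_all add: op_mat_def coords_def scalar_prod_def lessThan_atLeast0[symmetric] cinner_basis_expand[OF assms])

lemma mixed_mat_ident:
  assumes "orthonormal n e"
  shows "mixed_mat n e (\<lambda>x. x) e = 1\<^sub>m n"
  using assms by (intro eq_matI) (auto simp: mixed_mat_def orthonormalD)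

lemma mat_adjoint_index:
  assumes "U \<in> carrier_mat n n" "i < n" "j < n"
  shows "mat_adjoint U $$ (i, j) = cnj (U $$ (j, i))" "mat_adjoint U \<in> carrier_mat n n"
  using assms by (auto simp: mat_adjoint_def mat_of_rows_def)

lemma mat_adjoint_mixed_mat: "mat_adjoint (mixed_mat n e (\<lambda>x. x) f) = mixed_mat n f (\<lambda>x. x) e"
proof (rule eq_matI)
  show d: "dim_row (mat_adjoint (mixed_mat n e (\<lambda>x. x) f)) = dim_row (mixed_mat n f (\<lambda>x. x) e)"
    "dim_col (mat_adjoint (mixed_mat n e (\<lambda>x. x) f)) = dim_col (mixed_mat n f (\<lambda>x. x) e)"
    by (simp_all add: mat_adjoint_def mixed_mat_def)
  fix i j assume "i < dim_row (mixed_mat n f (\<lambda>x. x) e)" "j < dim_col (mixed_mat n f (\<lambda>x. x) e)"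
  then have ij: "i < n" "j < n" by (simp_all add: mixed_mat_def)
  show "mat_adjoint (mixed_mat n e (\<lambda>x. x) f) $$ (i, j) = mixed_mat n f (\<lambda>x. x) e $$ (i, j)"
    unfolding mat_adjoint_index(1)[OF mixed_mat_carrier ij]
    using ij by (simp add: mixed_mat_def cinner_commute[symmetric])
qed

text \<open>The change-of-basis matrix is the identity operator read in two bases; its adjoint is
  the reverse change of basis.\<close>

lemma unitarily_similar_op_mat:
  assumes A: "bounded_clinear A" and e: "orthonormal_basis n e" and f: "orthonormal_basis n f"
  shows "unitarily_similar (op_mat n e A) (op_mat n f A)"
proof -
  let ?U = "mixed_mat n e (\<lambda>x. x) f" and ?V = "mixed_mat n f (\<lambda>x. x) e"
  have o: "orthonormal n e" "orthonormal n f" using e f by (auto simp: orthonormal_basis_def)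
  note mult = mixed_mat_mult[OF bounded_clinear_ident] mixed_mat_mult[OF A]
  have "similar_mat_wit (op_mat n e A) (op_mat n f A) ?U (mat_adjoint ?U)"
    unfolding mat_adjoint_mixed_mat
  proof (rule similar_mat_witI)
    show "?U * ?V = 1\<^sub>m n" "?V * ?U = 1\<^sub>m n"
      by (simp_all add: mult e f mixed_mat_ident o)
    show "op_mat n e A = ?U * op_mat n f A * ?V"
      by (simp add: op_mat_eq_mixed_mat mult e f)
  qed (simp_all add: op_mat_eq_mixed_mat)
  then show ?thesis unfolding unitarily_similar_def by blast
qed

text \<open>Conversely, the columns of U read in the basis \<open>e\<close> define \<open>f\<close>.
  Orthonormality is U^* U = I, and spanning follows by counting dimensions.\<close>

lemma unitarily_similar_op_matE:
  fixes A :: "'a::complex_hilbert_space \<Rightarrow> 'a"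
  assumes A: "bounded_clinear A" and e: "orthonormal_basis n e"
    and N: "unitarily_similar (op_mat n e A) N"
  obtains f where "orthonormal_basis n f" "op_mat n f A = N"
proof -
  obtain U where wit: "similar_mat_wit (op_mat n e A) N U (mat_adjoint U)"
    using N by (auto simp: unitarily_similar_def)
  have "op_mat n e A \<in> carrier_mat n n" by (simp add: op_mat_def)
  from similar_mat_witD2[OF this wit]
  have U: "U * mat_adjoint U = 1\<^sub>m n" "mat_adjoint U * U = 1\<^sub>m n"
    "op_mat n e A = U * N * mat_adjoint U"
    "N \<in> carrier_mat n n" "U \<in> carrier_mat n n" "mat_adjoint U \<in> carrier_mat n n"
    by auto
  have oe: "orthonormal n e" using e by (simp add: orthonormal_basis_def)
  define f where "f j = (\<Sum>i<n. U $$ (i, j) *\<^sub>C e i)" for j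
  have Uf: "U = mixed_mat n e (\<lambda>x. x) f"
    using U(5) by (intro eq_matI) (auto simp: mixed_mat_def f_def orthonormal_cinner_sum[OF oe])
  have "orthonormal n f"
    unfolding orthonormal_def
  proof (intro allI impI)
    fix j k assume jk: "j < n" "k < n"
    have "cinner (f j) (f k) = (\<Sum>i<n. cnj (U $$ (i, k)) * cinner (f j) (e i))"
      unfolding f_def[of k] cinner_sum_right cinner_scaleC_right ..
    also have "\<dots> = (\<Sum>i<n. mat_adjoint U $$ (k, i) * U $$ (i, j))"
      using jk U(5) by (intro sum.cong) (simp_all add: f_def orthonormal_cinner_sum[OF oe] mat_adjoint_index)
    also have "\<dots> = (mat_adjoint U * U) $$ (k, j)"
      using jk U(5,6) by (simp add: scalar_prod_def lessThan_atLeast0)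
    also have "\<dots> = (if j = k then 1 else 0)" using jk by (simp add: U(2))
    finally show "cinner (f j) (f k) = (if j = k then 1 else 0)" .
  qed
  then have f: "orthonormal_basis n f" by (rule orthonormal_basis_maximal[OF e])
  have "op_mat n f A = mixed_mat n f (\<lambda>x. x) e * op_mat n e A * mixed_mat n e (\<lambda>x. x) f"
    by (simp add: op_mat_eq_mixed_mat mixed_mat_mult bounded_clinear_ident A e)
  also have "\<dots> = mat_adjoint U * (U * N * mat_adjoint U) * U"
    by (simp add: Uf[symmetric] mat_adjoint_mixed_mat[of n e f, symmetric] U(3)[symmetric])
  also have "\<dots> = (mat_adjoint U * U) * N * (mat_adjoint U * U)"
    using U(4-6) by (simp add: assoc_mult_mat[of _ n n _ n _ n])
  also have "\<dots> = N" using U(4) by (simp add: U(2))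
  finally show ?thesis using f that by blast
qed

lemma matrix_inverse_exists:
  fixes M :: "complex mat"
  assumes M: "M \<in> carrier_mat n n" and inj: "\<And>v. v \<in> carrier_vec n \<Longrightarrow> M *\<^sub>v v = 0\<^sub>v n \<Longrightarrow> v = 0\<^sub>v n"
  obtains D where "D \<in> carrier_mat n n" "M * D = 1\<^sub>m n" "D * M = 1\<^sub>m n"
proof -
  have "det M \<noteq> 0" using det_0_iff_vec_prod_zero_field[OF M] inj by blast
  from det_non_zero_imp_unit[OF M this, where b = "()"]
  show ?thesis using that by (auto simp: Units_def ring_mat_def)
qed

text \<open>The kernel of the matrix of T is trivial, so it has an inverse D, which is carried back
  to an operator R; both compositions are verified in coordinates.\<close>

lemma finite_dim_invertible:
  fixes T :: "'a::complex_hilbert_space \<Rightarrow> 'a" and e :: "nat \<Rightarrow> 'a"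
  assumes T: "bounded_clinear T" and e: "orthonormal_basis n e" and inj: "\<And>x. T x = 0 \<Longrightarrow> x = 0"
  shows "op_invertible T"
proof -
  have oe: "orthonormal n e" using e by (simp add: orthonormal_basis_def)
  have M: "op_mat n e T \<in> carrier_mat n n" by (simp add: op_mat_def)
  obtain D where D: "D \<in> carrier_mat n n" "op_mat n e T * D = 1\<^sub>m n" "D * op_mat n e T = 1\<^sub>m n"
  proof (rule matrix_inverse_exists[OF M])
    fix v :: "complex Matrix.vec" assume v: "v \<in> carrier_vec n" "op_mat n e T *\<^sub>v v = 0\<^sub>v n"
    define x where "x = (\<Sum>i<n. v $ i *\<^sub>C e i)"
    have vx: "v = coords n e x" using coords_sum[OF oe v(1)] by (simp add: x_def)
    have "op_mat n e T *\<^sub>v coords n e x = 0\<^sub>v n" using v(2) by (simp only: vx[symmetric])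
    then have "coords n e (T x) = coords n e 0"
      by (simp only: op_mat_mult_coords[OF T e] coords_zero)
    then have "x = 0" by (rule inj[OF coords_inj[OF e]])
    then show "v = 0\<^sub>v n" by (simp only: vx coords_zero)
  qed
  define R where "R x = (\<Sum>i<n. (\<Sum>j<n. D $$ (i, j) * cinner x (e j)) *\<^sub>C e i)" for x
  have cR: "coords n e (R x) = D *\<^sub>v coords n e x" for x
    using D(1) by (intro eq_vecI)
      (auto simp: coords_def R_def orthonormal_cinner_sum[OF oe] scalar_prod_def atLeast0LessThan)
  have "bounded_clinear R"
  proof (rule bounded_clinearI)
    show "norm (R x) \<le> (\<Sum>i<n. (\<Sum>j<n. cmod (D $$ (i, j)) * norm (e j)) * norm (e i)) * norm x" for x
    proof -
      have "norm (R x) \<le> (\<Sum>i<n. (\<Sum>j<n. cmod (D $$ (i, j)) * (norm x * norm (e j))) * norm (e i))"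
        unfolding R_def
      proof (rule sum_norm_le)
        fix i
        have "cmod (\<Sum>j<n. D $$ (i, j) * cinner x (e j)) \<le> (\<Sum>j<n. cmod (D $$ (i, j)) * (norm x * norm (e j)))"
          by (intro sum_norm_le) (simp add: norm_mult mult_left_mono cmod_cinner_le)
        then show "norm ((\<Sum>j<n. D $$ (i, j) * cinner x (e j)) *\<^sub>C e i)
            \<le> (\<Sum>j<n. cmod (D $$ (i, j)) * (norm x * norm (e j))) * norm (e i)"
          by (simp add: norm_scaleC mult_right_mono)
      qed
      then show ?thesis by (simp add: sum_distrib_left sum_distrib_right mult_ac)
    qed
    show "R (x + y) = R x + R y" for x y
      by (simp only: R_def cinner_add_left distrib_left sum.distrib scaleC_add_left)
    show "R (c *\<^sub>C x) = c *\<^sub>C R x" for c x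
      by (simp only: R_def cinner_scaleC_left complex_vector.scale_sum_right scaleC_scaleC
          sum_distrib_left mult.left_commute)
  qed
  moreover have "T (R x) = x" "R (T x) = x" for x
  proof -
    have "op_mat n e T *\<^sub>v (D *\<^sub>v coords n e x) = coords n e x" "D *\<^sub>v (op_mat n e T *\<^sub>v coords n e x) = coords n e x"
      using assoc_mult_mat_vec[OF M D(1) coords_carrier[of n e x]]
        assoc_mult_mat_vec[OF D(1) M coords_carrier[of n e x]] by (simp_all add: D)
    then show "T (R x) = x" "R (T x) = x"
      by (auto intro!: coords_inj[OF e] simp: op_mat_mult_coords[OF T e] cR simp flip: op_mat_mult_coords[OF T e])
  qed
  ultimately show ?thesis by (intro op_invertibleI)
qed

section \<open>The finite-dimensional normal form\<close>

text \<open>In terms of the adjoint this is L^* x = conj s x. In ||L (x + t y)|| \<le> ||x + t y||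
  equality holds at t = 0, so the part linear in t has to vanish.\<close>

lemma contraction_unimodular_eigenvector:
  assumes L: "bounded_clinear L" "\<And>x. norm (L x) \<le> norm x" and x: "L x = s *\<^sub>C x" and s: "cmod s = 1"
  shows "cinner (L y) x = s * cinner y x"
proof -
  define D where "D = cinner (L y) (s *\<^sub>C x) - cinner y x"
  have quad: "2 * Re (t * D) \<le> (cmod t)\<^sup>2 * (norm y)\<^sup>2" for t
  proof -
    have "(norm (s *\<^sub>C x + t *\<^sub>C L y))\<^sup>2 \<le> (norm (x + t *\<^sub>C y))\<^sup>2"
      using L(2)[of "x + t *\<^sub>C y"] by (simp add: bounded_clinearD[OF L(1)] x power_mono)
    moreover have "Re (cinner (s *\<^sub>C x) (t *\<^sub>C L y)) = Re (t * cinner (L y) (s *\<^sub>C x))"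
      by (subst cinner_commute) (simp only: cinner_scaleC_left complex_cnj(1) cnj.sel(1))
    moreover have "Re (cinner x (t *\<^sub>C y)) = Re (t * cinner y x)"
      by (subst cinner_commute) (simp only: cinner_scaleC_left complex_cnj(1) cnj.sel(1))
    moreover have "Re (t * D) = Re (t * cinner (L y) (s *\<^sub>C x)) - Re (t * cinner y x)"
      by (simp only: D_def right_diff_distrib minus_complex.sel)
    moreover have "0 \<le> (norm (t *\<^sub>C L y))\<^sup>2" by simp
    moreover have "(norm (s *\<^sub>C x))\<^sup>2 = (norm x)\<^sup>2" "(norm (t *\<^sub>C y))\<^sup>2 = (cmod t)\<^sup>2 * (norm y)\<^sup>2"
      using s by (simp_all add: norm_scaleC power_mult_distrib)
    ultimately show ?thesis unfolding norm_add_sq by linarith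
  qed
  obtain w where w: "cmod w = 1" "w * D = of_real (cmod D)" by (rule phase_exists)
  \<comment> \<open>For t = h w the quadratic bound becomes 2 |D| \<le> h ||y||^2 \<le> |D|. The
    summand 1 keeps the denominator positive when y = 0.\<close>
  define h where "h = cmod D / (1 + (norm y)\<^sup>2)"
  have pos: "0 < 1 + (norm y)\<^sup>2" by (simp add: add_pos_nonneg)
  have "D = 0"
  proof (rule ccontr)
    assume D: "D \<noteq> 0"
    then have h: "0 < h" using pos by (simp add: h_def)
    have "2 * (h * cmod D) \<le> h * (h * (norm y)\<^sup>2)"
      using quad[of "of_real h * w"] w h by (simp add: norm_mult mult.assoc power2_eq_square)
    then have "2 * cmod D \<le> h * (norm y)\<^sup>2" using h by (simp add: mult.left_commute[of 2])
    also have "\<dots> \<le> h * (1 + (norm y)\<^sup>2)" using h by (intro mult_left_mono) auto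
    also have "\<dots> = cmod D" using pos by (simp add: h_def)
    finally show False using D by simp
  qed
  then have "cnj s * cinner (L y) x = cinner y x" by (simp add: D_def cinner_scaleC_right)
  then have "s * cinner y x = s * cnj s * cinner (L y) x" by (simp add: mult.assoc)
  also have "s * cnj s = 1" using s complex_norm_square[of s] by simp
  finally show ?thesis by simp
qed

lemma smult_mat_mult_vec:
  fixes M :: "complex mat"
  assumes "M \<in> carrier_mat n m" "v \<in> carrier_vec m"
  shows "(c \<cdot>\<^sub>m M) *\<^sub>v v = c \<cdot>\<^sub>v (M *\<^sub>v v)"
  using assms by (intro eq_vecI) (auto simp: scalar_prod_def sum_distrib_left mult.assoc)

lemma diag_block_index:
  assumes C: "C \<in> carrier_mat m m" and ij: "i < p + q + m" "j < p + q + m"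
  shows "diag_block_mat [1\<^sub>m p, 0\<^sub>m q q, C] $$ (i, j) =
    (if i < p \<and> i = j then 1 else if p + q \<le> i \<and> p + q \<le> j then C $$ (i - (p + q), j - (p + q))
     else (0 :: complex))"
proof -
  have C': "dim_row C = m" "dim_col C = m" using C by auto
  have s: "i - p - q = i - (p + q)" "j - p - q = j - (p + q)" by auto
  show ?thesis using ij by (auto simp: C' Let_def s)
qed

lemma diag_block_carrier:
  assumes "C \<in> carrier_mat m m"
  shows "diag_block_mat [1\<^sub>m p, 0\<^sub>m q q, C] \<in> carrier_mat (p + (q + m)) (p + (q + m))"
  using assms by (auto simp: Let_def)

lemma diag_block_mult_vec:
  assumes C: "C \<in> carrier_mat m m" and w: "w1 \<in> carrier_vec p" "w2 \<in> carrier_vec q" "w3 \<in> carrier_vec m"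
  shows "diag_block_mat [1\<^sub>m p, 0\<^sub>m q q, C] *\<^sub>v (w1 @\<^sub>v (w2 @\<^sub>v w3)) = w1 @\<^sub>v (0\<^sub>v q @\<^sub>v (C *\<^sub>v (w3 :: complex Matrix.vec)))"
proof -
  let ?B = "four_block_mat (0\<^sub>m q q) (0\<^sub>m q m) (0\<^sub>m m q) C"
  have z: "0\<^sub>m a b *\<^sub>v v = 0\<^sub>v a" if "v \<in> carrier_vec b" for a b and v :: "complex Matrix.vec"
    using that by (intro eq_vecI) auto
  have B: "?B \<in> carrier_mat (q + m) (q + m)" using C by simp
  have d: "diag_block_mat [1\<^sub>m p, 0\<^sub>m q q, C] = four_block_mat (1\<^sub>m p) (0\<^sub>m p (q + m)) (0\<^sub>m (q + m) p) ?B"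
    using C by (simp add: diag_block_mat.simps(2)[where As = "B # Bs" for B Bs] Let_def del: diag_block_mat.simps)
  have "?B *\<^sub>v (w2 @\<^sub>v w3) = 0\<^sub>v q @\<^sub>v (C *\<^sub>v w3)"
    using four_block_mat_mult_vec[of "0\<^sub>m q q" q q "0\<^sub>m q m" m "0\<^sub>m m q" m C w2 w3] C w
    by (simp add: z)
  then show ?thesis
    unfolding d
    using four_block_mat_mult_vec[of "1\<^sub>m p" p p "0\<^sub>m p (q + m)" "q + m" "0\<^sub>m (q + m) p" "q + m" ?B w1 "w2 @\<^sub>v w3"]
      B C w by (simp add: z)
qed

text \<open>An orthonormal family is extended first inside \<open>E1\<close>, then inside
  \<open>E0\<close>, then in the whole space. The first two pieces reduce A by
  \<open>contraction_unimodular_eigenvector\<close>, and C is the compression of A / \<mu> to the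
  last one.\<close>

lemma normal_form_exists:
  fixes A :: "'a::complex_hilbert_space \<Rightarrow> 'a"
  assumes A: "bounded_clinear A" and L: "contraction L" "1 \<in> op_spectrum L"
    and AL: "A = (\<lambda>x. (\<mu> / 2) *\<^sub>C (x + L x))" and m0: "\<mu> \<noteq> 0" and e: "orthonormal_basis n e"
  obtains p q C where "1 \<le> p" "p \<le> n" "q \<le> n - p" "C \<in> carrier_mat (n - p - q) (n - p - q)"
    "invertible_mat C" "mat_opnorm (C - (1 / 2) \<cdot>\<^sub>m 1\<^sub>m (n - p - q)) \<le> 1 / 2"
    "unitarily_similar (op_mat n e A) (\<mu> \<cdot>\<^sub>m diag_block_mat [1\<^sub>m p, 0\<^sub>m q q, C])"
proof -
  have L': "bounded_clinear L" "\<And>x. norm (L x) \<le> norm x" using L(1) by (auto simp: contraction_iff)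
  note lL = bounded_clinearD[OF L'(1)]
  define E1 where "E1 = {x. L x = x}"
  define E0 where "E0 = {x. L x = - 1 *\<^sub>C x}"
  have E1: "cinner (A y) x = \<mu> * cinner y x" "A x = \<mu> *\<^sub>C x" if "x \<in> E1" for x y
  proof -
    have "L x = 1 *\<^sub>C x" using that by (simp add: E1_def)
    then have "cinner (L y) x = cinner y x"
      using contraction_unimodular_eigenvector[OF L', of x 1 y] by simp
    then show "cinner (A y) x = \<mu> * cinner y x"
      by (simp add: AL cinner_scaleC_left cinner_add_left)
    have "(\<mu> / 2) *\<^sub>C (x + x) = (\<mu> / 2 + \<mu> / 2) *\<^sub>C x"
      by (simp only: scaleC_add_left scaleC_add_right)
    then show "A x = \<mu> *\<^sub>C x" using that by (simp add: AL E1_def)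
  qed
  have E0: "cinner (A y) x = 0" "A x = 0" if "x \<in> E0" for x y
  proof -
    have x: "L x = - 1 *\<^sub>C x" using that by (simp add: E0_def)
    then have "cinner (L y) x = - cinner y x"
      using contraction_unimodular_eigenvector[OF L', of x "- 1" y] by simp
    then show "cinner (A y) x = 0"
      by (simp add: AL cinner_scaleC_left cinner_add_left)
    show "A x = 0" by (simp add: AL x)
  qed
  \<comment> \<open>\<open>E0\<close> is the whole kernel of A, which is why C will have trivial
    kernel.\<close>
  have E0I: "x \<in> E0" if "A x = 0" for x
    using that m0 by (simp add: AL E0_def complex_vector.scale_eq_0_iff eq_neg_iff_add_eq_0 add.commute)
  have o0: "orthonormal 0 e" by (simp add: orthonormal_def)
  have E1s: "\<forall>c. \<forall>x\<in>E1. c *\<^sub>C x \<in> E1" by (simp add: E1_def lL)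
  obtain p g where g: "orthonormal p g" "\<forall>i<p. g i \<in> E1"
    and g3: "\<forall>x\<in>E1. (\<forall>i<p. cinner x (g i) = 0) \<longrightarrow> x = 0"
    using orthonormal_extend_within[OF e o0 E1s] by auto
  have E0s: "\<forall>c. \<forall>x\<in>E0. c *\<^sub>C x \<in> E0" by (simp add: E0_def lL)
  \<comment> \<open>\<open>pq\<close> stands for p + q, so the zero block has size pq - p.\<close>
  obtain pq h where h: "p \<le> pq" "\<forall>i<p. h i = g i" "orthonormal pq h"
    "\<forall>i. p \<le> i \<longrightarrow> i < pq \<longrightarrow> h i \<in> E0"
    "\<forall>x\<in>E0. (\<forall>i<pq. cinner x (h i) = 0) \<longrightarrow> x = 0"
    using orthonormal_extend_within[OF e g(1) E0s] by (elim exE conjE) (rule that)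
  have Us: "\<forall>c. \<forall>x\<in>UNIV. c *\<^sub>C x \<in> (UNIV :: 'a set)" by simp
  obtain N f where f: "pq \<le> N" "\<forall>i<pq. f i = h i" "orthonormal N f"
    and "\<forall>x\<in>UNIV. (\<forall>i<N. cinner x (f i) = 0) \<longrightarrow> x = 0"
    using orthonormal_extend_within[OF e h(3) Us] by (elim exE conjE) (rule that)
  then have f4: "x = 0" if "\<And>i. i < N \<Longrightarrow> cinner x (f i) = 0" for x using that by simp
  have fB: "orthonormal_basis N f" by (rule orthonormal_basisI[OF f(3) f4])
  then have N: "N = n" using orthonormal_basis_dim[OF e] orthonormal_basis_dim[OF fB] by simp
  note f = f[unfolded N] and f4 = f4[unfolded N] and fB = fB[unfolded N]
  have f1: "f i \<in> E1" if "i < p" for i using that f(2) h(1,2) g(2) by simp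
  have f0: "f i \<in> E0" if "p \<le> i" "i < pq" for i using that f(2) h(4) by simp
  define m where "m = n - pq"
  define k where "k j = f (pq + j)" for j
  have k: "orthonormal m k"
    using f(3) by (auto simp: orthonormal_def m_def k_def)
  define C where "C = Matrix.mat m m (\<lambda>(i, j). cinner (A (k j)) (k i) / \<mu>)"
  have C: "C \<in> carrier_mat m m" by (simp add: C_def)
  define z where "z v = (\<Sum>j<m. v $ j *\<^sub>C k j)" for v
  have Cz: "(C *\<^sub>v v) $ i = cinner (A (z v)) (k i) / \<mu>" if "v \<in> carrier_vec m" "i < m" for v i
    using that by (simp add: C_def z_def scalar_prod_def lessThan_atLeast0 bounded_clinearD[OF A]
        cinner_sum_left cinner_scaleC_left sum_divide_distrib mult.commute)
  have vz: "v $ i = cinner (z v) (k i)" if "i < m" for v i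
    unfolding z_def using orthonormal_cinner_sum[OF k that] by simp
  have zf: "cinner (z v) (f i) = 0" if "i < pq" for v i
  proof -
    have "cinner (k j) (f i) = 0" if "j < m" for j
      using that \<open>i < pq\<close> orthonormalD[OF f(3), of "pq + j" i] by (auto simp: k_def m_def)
    then show ?thesis by (simp add: z_def cinner_sum_left cinner_scaleC_left)
  qed
  have nz: "norm (z v) = euclidean_norm v" if "v \<in> carrier_vec m" for v
  proof -
    have "(norm (z v))\<^sup>2 = (euclidean_norm v)\<^sup>2"
      using that by (simp add: z_def orthonormal_norm_sum[OF k] euclidean_norm_sq)
    then show ?thesis by (simp add: power2_eq_iff_nonneg)
  qed
  have p: "1 \<le> p"
  proof (rule ccontr)
    assume "\<not> 1 \<le> p"
    then have E1_0: "x = 0" if "x \<in> E1" for x using g3 that by simp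
    \<comment> \<open>Without fixed vectors L - I would be injective, hence invertible in finite
      dimension, against 1 being in the spectrum.\<close>
    have "op_invertible (\<lambda>x. L x - 1 *\<^sub>C x)"
      by (rule finite_dim_invertible[OF bounded_clinear_minus_scaleC[OF L'(1)] e])
        (simp add: E1_0 E1_def)
    then show False using L(2) by (simp add: op_spectrum_iff)
  qed
  have pqn: "pq \<le> n" by (rule f(1))
  have "p \<le> n" "pq - p \<le> n - p" "n - p - (pq - p) = m" using h(1) pqn by (auto simp: m_def)
  moreover have "invertible_mat C"
  proof -
    obtain D where "D \<in> carrier_mat m m" "C * D = 1\<^sub>m m" "D * C = 1\<^sub>m m"
    proof (rule matrix_inverse_exists[OF C])
      fix v :: "complex Matrix.vec" assume v: "v \<in> carrier_vec m" and Cv: "C *\<^sub>v v = 0\<^sub>v m"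
      \<comment> \<open>Coefficients against \<open>E1\<close> and \<open>E0\<close> vanish by
        reduction, the others because C v = 0. Then z v lies in \<open>E0\<close> and is orthogonal
        to the first \<open>pq\<close> basis vectors, so it is zero.\<close>
      have "A (z v) = 0"
      proof (rule f4)
        fix i assume i: "i < n"
        consider "i < p" | "p \<le> i" "i < pq" | "pq \<le> i" by linarith
        then show "cinner (A (z v)) (f i) = 0"
        proof cases
          case 1
          then show ?thesis using E1(1)[OF f1[OF 1]] zf[of i v] h(1) by simp
        next
          case 2
          then show ?thesis using E0(1)[OF f0] by simp
        next
          case 3
          then have "i - pq < m" "f i = k (i - pq)" using i by (auto simp: m_def k_def)
          then show ?thesis using Cz[OF v, of "i - pq"] Cv m0 by simp
        qed
      qed
      then have "z v = 0" using h(5)[rule_format, OF E0I, of "z v"] zf[of _ v] f(2) by simp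
      then show "v = 0\<^sub>v m" using vz[where v = v] v by (intro eq_vecI) auto
    qed
    then show ?thesis using C unfolding invertible_mat_def inverts_mat_def by auto
  qed
  moreover have "mat_opnorm (C - (1 / 2) \<cdot>\<^sub>m 1\<^sub>m m) \<le> 1 / 2"
  proof (subst mat_opnorm_le_iff[where m = m])
    show "\<forall>v\<in>carrier_vec m. euclidean_norm ((C - (1 / 2) \<cdot>\<^sub>m 1\<^sub>m m) *\<^sub>v v) \<le> 1 / 2 * euclidean_norm v"
    proof
      fix v :: "complex Matrix.vec" assume v: "v \<in> carrier_vec m"
      \<comment> \<open>C v - v/2 lists the coefficients of (1/2) L (z v) against \<open>k\<close>,
        so Bessel's inequality and the contraction property give the norm bound.\<close>
      define u where "u = (1 / 2) *\<^sub>C L (z v)"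
      let ?w = "C *\<^sub>v v - (1 / 2) \<cdot>\<^sub>v v"
      have w: "?w $ i = cinner u (k i)" if "i < m" for i
      proof -
        have "(C *\<^sub>v v) $ i = (v $ i + cinner (L (z v)) (k i)) / 2"
          unfolding Cz[OF v that] vz[OF that, of v] using m0
          by (simp add: AL cinner_scaleC_left cinner_add_left)
        moreover have "?w $ i = (C *\<^sub>v v) $ i - 1 / 2 * v $ i" using that v C by simp
        ultimately show ?thesis by (simp only:) (simp add: u_def cinner_scaleC_left add_divide_distrib)
      qed
      have "(euclidean_norm ?w)\<^sup>2 = (\<Sum>i<m. (cmod (cinner u (k i)))\<^sup>2)"
        unfolding euclidean_norm_sq using v C w by (intro sum.cong) auto
      also have "\<dots> \<le> (norm u)\<^sup>2" by (rule bessel[OF k])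
      finally have "euclidean_norm ?w \<le> norm u" by (rule power2_le_imp_le) simp
      also have "\<dots> \<le> 1 / 2 * euclidean_norm v"
        using L'(2)[of "z v"] nz[OF v] by (simp add: u_def norm_scaleC norm_divide)
      finally show "euclidean_norm ((C - (1 / 2) \<cdot>\<^sub>m 1\<^sub>m m) *\<^sub>v v) \<le> 1 / 2 * euclidean_norm v"
        unfolding sub_half_mult_vec[OF C v] .
    qed
  qed (use C in auto)
  moreover have "op_mat n f A = \<mu> \<cdot>\<^sub>m diag_block_mat [1\<^sub>m p, 0\<^sub>m (pq - p) (pq - p), C]"
  proof -
    have nn: "p + (pq - p + m) = n" "p + (pq - p) = pq" using h(1) pqn by (auto simp: m_def)
    note D = diag_block_carrier[OF C, of p "pq - p", unfolded nn]
    have ip: "i < p + (pq - p) + m" if "i < n" for i using that nn by simp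
    show ?thesis
    proof (rule eq_matI)
      fix i j assume "i < dim_row (\<mu> \<cdot>\<^sub>m diag_block_mat [1\<^sub>m p, 0\<^sub>m (pq - p) (pq - p), C])"
        "j < dim_col (\<mu> \<cdot>\<^sub>m diag_block_mat [1\<^sub>m p, 0\<^sub>m (pq - p) (pq - p), C])"
      then have ij: "i < n" "j < n" using D by auto
      have rhs: "(\<mu> \<cdot>\<^sub>m diag_block_mat [1\<^sub>m p, 0\<^sub>m (pq - p) (pq - p), C]) $$ (i, j) =
        \<mu> * (if i < p \<and> i = j then 1 else if pq \<le> i \<and> pq \<le> j then C $$ (i - pq, j - pq) else 0)"
      proof -
        have d: "i < dim_row (diag_block_mat [1\<^sub>m p, 0\<^sub>m (pq - p) (pq - p), C])"
          "j < dim_col (diag_block_mat [1\<^sub>m p, 0\<^sub>m (pq - p) (pq - p), C])"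
          unfolding carrier_matD[OF D] by (rule ij)+
        show ?thesis
          unfolding index_smult_mat(1)[OF d] diag_block_index[OF C ip[OF ij(1)] ip[OF ij(2)]] nn ..
      qed
      have on: "cinner (f j) (f i) = (if i = j then 1 else 0)" using orthonormalD[OF f(3) ij(2,1)] by auto
      have lhs: "op_mat n f A $$ (i, j) = cinner (A (f j)) (f i)" using ij by (simp add: op_mat_def)
      \<comment> \<open>The first two column ranges use the eigenvector equations; for the remaining
        columns, the first two row ranges use the adjoint relations, and the corner is C by
        definition.\<close>
      consider "j < p" | "p \<le> j" "j < pq" | "pq \<le> j" "i < p" | "pq \<le> j" "p \<le> i" "i < pq" | "pq \<le> j" "pq \<le> i"
        by linarith
      then show "op_mat n f A $$ (i, j) = (\<mu> \<cdot>\<^sub>m diag_block_mat [1\<^sub>m p, 0\<^sub>m (pq - p) (pq - p), C]) $$ (i, j)"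
        unfolding rhs lhs
      proof cases
        case 1
        then show "cinner (A (f j)) (f i) = \<mu> * (if i < p \<and> i = j then 1 else if pq \<le> i \<and> pq \<le> j then C $$ (i - pq, j - pq) else 0)"
          using E1(2)[OF f1[OF 1]] h(1) by (auto simp: cinner_scaleC_left on)
      next
        case 2
        then show "cinner (A (f j)) (f i) = \<mu> * (if i < p \<and> i = j then 1 else if pq \<le> i \<and> pq \<le> j then C $$ (i - pq, j - pq) else 0)"
          using E0(2)[OF f0[OF 2]] by auto
      next
        case 3
        then show "cinner (A (f j)) (f i) = \<mu> * (if i < p \<and> i = j then 1 else if pq \<le> i \<and> pq \<le> j then C $$ (i - pq, j - pq) else 0)"
          using E1(1)[OF f1[OF 3(2)]] h(1) by (auto simp: on)
      next
        case 4
        then show "cinner (A (f j)) (f i) = \<mu> * (if i < p \<and> i = j then 1 else if pq \<le> i \<and> pq \<le> j then C $$ (i - pq, j - pq) else 0)"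
          using E0(1)[OF f0[OF 4(2,3)]] by auto
      next
        case 5
        then show "cinner (A (f j)) (f i) = \<mu> * (if i < p \<and> i = j then 1 else if pq \<le> i \<and> pq \<le> j then C $$ (i - pq, j - pq) else 0)"
          using ij h(1) m0 by (simp add: C_def k_def m_def diff_less_mono)
      qed
    qed (use D in \<open>auto simp: op_mat_def\<close>)
  qed
  ultimately show ?thesis
    using that[of p "pq - p" C] p C unitarily_similar_op_mat[OF A e fB] by simp
qed

text \<open>In the basis realising the block form, A / \<mu> - I/2 acts as I/2, -I/2 and C - I/2 on
  orthogonal summands, so the three bounds add in squares.\<close>

lemma normal_form_onorm:
  fixes A :: "'a::complex_hilbert_space \<Rightarrow> 'a"
  assumes A: "bounded_clinear A" and A0: "A x0 \<noteq> 0" and e: "orthonormal_basis n e"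
    and pq: "p \<le> n" "q \<le> n - p" and C: "C \<in> carrier_mat (n - p - q) (n - p - q)"
    and nC: "mat_opnorm (C - (1 / 2) \<cdot>\<^sub>m 1\<^sub>m (n - p - q)) \<le> 1 / 2"
    and us: "unitarily_similar (op_mat n e A) (\<mu> \<cdot>\<^sub>m diag_block_mat [1\<^sub>m p, 0\<^sub>m q q, C])"
  shows "\<mu> \<noteq> 0" "onorm (\<lambda>x. (1 / \<mu>) *\<^sub>C A x - (1 / 2) *\<^sub>C x) \<le> 1 / 2"
proof -
  define m where "m = n - p - q"
  note C = C[folded m_def] and nC = nC[folded m_def]
  have n: "n = p + (q + m)" using pq by (simp add: m_def)
  let ?D = "diag_block_mat [1\<^sub>m p, 0\<^sub>m q q, C]"
  have D: "?D \<in> carrier_mat n n" unfolding n by (rule diag_block_carrier[OF C])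
  obtain f where f: "orthonormal_basis n f" "op_mat n f A = \<mu> \<cdot>\<^sub>m ?D"
    using unitarily_similar_op_matE[OF A e us] .
  have cA: "coords n f (A x) = \<mu> \<cdot>\<^sub>v (?D *\<^sub>v coords n f x)" for x
    unfolding op_mat_mult_coords[OF A f(1), symmetric] f(2) by (rule smult_mat_mult_vec[OF D coords_carrier])
  \<comment> \<open>A zero factor would annihilate the matrix of A, contradicting A x0 \<noteq>
    0.\<close>
  show m0: "\<mu> \<noteq> 0"
  proof
    assume "\<mu> = 0"
    then have "coords n f (A x0) = coords n f 0"
      unfolding cA using D by (intro eq_vecI) (auto simp: coords_def simp del: diag_block_mat.simps)
    then show False using coords_inj[OF f(1)] A0 by blast
  qed
  show "onorm (\<lambda>x. (1 / \<mu>) *\<^sub>C A x - (1 / 2) *\<^sub>C x) \<le> 1 / 2"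
  proof (rule onorm_bound)
    fix x
    let ?w = "coords n f x"
    define w1 where "w1 = vec_first ?w p"
    define w' where "w' = vec_last ?w (q + m)"
    define w2 where "w2 = vec_first w' q"
    define w3 where "w3 = vec_last w' m"
    have wc: "w1 \<in> carrier_vec p" "w2 \<in> carrier_vec q" "w3 \<in> carrier_vec m" "w' \<in> carrier_vec (q + m)"
      by (simp_all add: w1_def w2_def w3_def w'_def)
    have w': "w' = w2 @\<^sub>v w3" using wc(4) by (simp add: w2_def w3_def)
    have w: "?w = w1 @\<^sub>v (w2 @\<^sub>v w3)"
      unfolding w'[symmetric] w1_def w'_def using coords_carrier[of n f x] unfolding n by simp
    define r where "r = (C - (1 / 2) \<cdot>\<^sub>m 1\<^sub>m m) *\<^sub>v w3"
    have rc: "r \<in> carrier_vec m"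
      unfolding r_def using C wc by (intro mult_mat_vec_carrier minus_carrier_mat) auto
    have "coords n f ((1 / \<mu>) *\<^sub>C A x - (1 / 2) *\<^sub>C x) = ?D *\<^sub>v ?w - (1 / 2) \<cdot>\<^sub>v ?w"
    proof (rule eq_vecI)
      fix i assume "i < dim_vec (?D *\<^sub>v ?w - (1 / 2) \<cdot>\<^sub>v ?w)"
      then have i: "i < n" by (simp add: coords_def)
      have "cinner (A x) (f i) = \<mu> * (?D *\<^sub>v ?w) $ i"
        using arg_cong[OF cA[of x], of "\<lambda>v. v $ i"] i D
        by (simp add: coords_def[of n f "A x"] del: diag_block_mat.simps)
      then show "coords n f ((1 / \<mu>) *\<^sub>C A x - (1 / 2) *\<^sub>C x) $ i = (?D *\<^sub>v ?w - (1 / 2) \<cdot>\<^sub>v ?w) $ i"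
        using i m0 D by (simp add: coords_def cinner_diff_left cinner_scaleC_left del: diag_block_mat.simps)
    qed (simp add: coords_def)
    also have "\<dots> = ((1 / 2) \<cdot>\<^sub>v w1) @\<^sub>v (((- 1 / 2) \<cdot>\<^sub>v w2) @\<^sub>v r)"
      unfolding w diag_block_mult_vec[OF C wc(1-3)] r_def sub_half_mult_vec[OF C wc(3)]
      using wc C by (intro eq_vecI) auto
    finally have "(norm ((1 / \<mu>) *\<^sub>C A x - (1 / 2) *\<^sub>C x))\<^sup>2
        = (euclidean_norm (((1 / 2) \<cdot>\<^sub>v w1) @\<^sub>v (((- 1 / 2) \<cdot>\<^sub>v w2) @\<^sub>v r)))\<^sup>2"
      using euclidean_norm_coords[OF f(1)] by metis
    also have "\<dots> = (1 / 2 * euclidean_norm w1)\<^sup>2 + ((1 / 2 * euclidean_norm w2)\<^sup>2 + (euclidean_norm r)\<^sup>2)"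
      by (simp add: euclidean_norm_append euclidean_norm_smult norm_divide)
    also have "\<dots> \<le> (1 / 2 * euclidean_norm w1)\<^sup>2 + ((1 / 2 * euclidean_norm w2)\<^sup>2 + (1 / 2 * euclidean_norm w3)\<^sup>2)"
    proof -
      have "euclidean_norm r \<le> 1 / 2 * euclidean_norm w3"
        unfolding r_def using nC wc C by (subst (asm) mat_opnorm_le_iff[where m = m]) auto
      then show ?thesis by (intro add_left_mono power_mono) auto
    qed
    also have "\<dots> = (1 / 2 * euclidean_norm ?w)\<^sup>2"
      unfolding w power_mult_distrib euclidean_norm_append by (simp add: algebra_simps)
    also have "\<dots> = (1 / 2 * norm x)\<^sup>2" by (simp only: euclidean_norm_coords[OF f(1)])
    finally show "norm ((1 / \<mu>) *\<^sub>C A x - (1 / 2) *\<^sub>C x) \<le> 1 / 2 * norm x"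
      by (rule power2_le_imp_le) simp
  qed simp
qed

section \<open>Assembly of the equivalences\<close>

theorem theorem1p1:
  fixes A :: "'a::complex_hilbert_space \<Rightarrow> 'a"
  assumes dim_ge_2: "\<exists>S :: 'a set. \<not> cdependent S \<and> card S = 2"
    and A_bounded: "bounded_clinear A"
    and A_nonzero: "A \<noteq> (\<lambda>_. 0)"
  shows "let
      a = (\<forall>B. bounded_clinear B \<longrightarrow>
            op_spectral_radius (A \<circ> B) \<le> numerical_radius A * numerical_radius B);
      b = (\<forall>B. bounded_clinear B \<and> rank_one B \<longrightarrow>
            op_spectral_radius (A \<circ> B) \<le> numerical_radius A * numerical_radius B);
      c = (\<lambda>\<mu>. unique_peripheral A \<mu> \<and> \<mu> \<noteq> 0 \<and>
            onorm (\<lambda>x. (1 / \<mu>) *\<^sub>C A x - (1 / 2) *\<^sub>C x) \<le> 1 / 2);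
      c' = (\<lambda>\<mu>. \<exists>L. contraction L \<and> 1 \<in> op_spectrum L \<and>
            A = (\<lambda>x. (\<mu> / 2) *\<^sub>C (x + L x)));
      d = (\<lambda>n e. \<exists>\<mu>. unique_peripheral A \<mu> \<and>
            (\<exists>p q C. 1 \<le> p \<and> p \<le> n \<and> q \<le> n - p \<and>
              C \<in> carrier_mat (n - p - q) (n - p - q) \<and> invertible_mat C \<and>
              mat_opnorm (C - (1 / 2) \<cdot>\<^sub>m 1\<^sub>m (n - p - q)) \<le> 1 / 2 \<and>
              unitarily_similar (op_mat n e A)
                (\<mu> \<cdot>\<^sub>m diag_block_mat [1\<^sub>m p, 0\<^sub>m q q, C])))
    in (a \<longleftrightarrow> b) \<and>
       (a \<longleftrightarrow> (\<exists>\<mu>. c \<mu>)) \<and>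
       (\<forall>\<mu>. c \<mu> \<longleftrightarrow> c' \<mu>) \<and>
       (\<forall>n e. orthonormal_basis n e \<longrightarrow> (a \<longleftrightarrow> d n e)) \<and>
       (\<forall>m C D. C \<in> carrier_mat m m \<and> D \<in> carrier_mat m m \<and> inverts_mat C D \<and> inverts_mat D C \<longrightarrow>
          (mat_opnorm (C - (1 / 2) \<cdot>\<^sub>m 1\<^sub>m m) \<le> 1 / 2 \<longleftrightarrow>
           mat_numerical_range D \<subseteq> {z. Re z \<ge> 1}))"
proof -
  obtain x0 where A0: "A x0 \<noteq> 0" using A_nonzero by blast
  note A = A_bounded
  let ?a = "\<forall>B. bounded_clinear B \<longrightarrow>
    op_spectral_radius (A \<circ> B) \<le> numerical_radius A * numerical_radius B"
  let ?b = "\<forall>B. bounded_clinear B \<and> rank_one B \<longrightarrow>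
    op_spectral_radius (A \<circ> B) \<le> numerical_radius A * numerical_radius B"
  let ?c = "\<lambda>\<mu>. unique_peripheral A \<mu> \<and> \<mu> \<noteq> 0 \<and>
    onorm (\<lambda>x. (1 / \<mu>) *\<^sub>C A x - (1 / 2) *\<^sub>C x) \<le> 1 / 2"
  let ?c' = "\<lambda>\<mu>. \<exists>L. contraction L \<and> 1 \<in> op_spectrum L \<and> A = (\<lambda>x. (\<mu> / 2) *\<^sub>C (x + L x))"
  let ?d = "\<lambda>n e. \<exists>\<mu>. unique_peripheral A \<mu> \<and>
    (\<exists>p q C. 1 \<le> p \<and> p \<le> n \<and> q \<le> n - p \<and>
      C \<in> carrier_mat (n - p - q) (n - p - q) \<and> invertible_mat C \<and>
      mat_opnorm (C - (1 / 2) \<cdot>\<^sub>m 1\<^sub>m (n - p - q)) \<le> 1 / 2 \<and>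
      unitarily_similar (op_mat n e A) (\<mu> \<cdot>\<^sub>m diag_block_mat [1\<^sub>m p, 0\<^sub>m q q, C]))"
  have cc': "?c \<mu> \<longleftrightarrow> ?c' \<mu>" for \<mu>
    by (rule peripheral_iff_contraction[OF A A0])
  have ca: ?a if "?c' \<mu>" for \<mu>
    using that half_contraction_spectral_bound[OF A _ _ _ A0] by blast
  have ab: "?a \<Longrightarrow> ?b" by blast
  have bc: "\<exists>\<mu>. ?c' \<mu>" if ?b
    by (rule rank_one_condition_imp_contraction[OF A A0]) (use that in blast)
  \<comment> \<open>The cycle runs from \<open>?a\<close> to \<open>?b\<close>, from there to a
    contraction, and back to \<open>?a\<close>.\<close>
  have ac: "?a \<longleftrightarrow> (\<exists>\<mu>. ?c \<mu>)"
    unfolding cc' using ca bc ab by blast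
  have ad: "?a \<longleftrightarrow> ?d n e" if e: "orthonormal_basis n e" for n e
  proof
    assume ?a
    then obtain \<mu> where \<mu>: "?c \<mu>" unfolding ac by blast
    then obtain L where L: "contraction L" "1 \<in> op_spectrum L" "A = (\<lambda>x. (\<mu> / 2) *\<^sub>C (x + L x))"
      unfolding cc' by blast
    from \<mu> have m: "unique_peripheral A \<mu>" "\<mu> \<noteq> 0" by auto
    show "?d n e" by (rule normal_form_exists[OF A L m(2) e]) (use m(1) in blast)
  next
    assume "?d n e"
    then obtain \<mu> p q C where d: "unique_peripheral A \<mu>" "p \<le> n" "q \<le> n - p"
      "C \<in> carrier_mat (n - p - q) (n - p - q)"
      "mat_opnorm (C - (1 / 2) \<cdot>\<^sub>m 1\<^sub>m (n - p - q)) \<le> 1 / 2"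
      "unitarily_similar (op_mat n e A) (\<mu> \<cdot>\<^sub>m diag_block_mat [1\<^sub>m p, 0\<^sub>m q q, C])" by blast
    \<comment> \<open>Peripheral uniqueness is already a clause of \<open>?d\<close>; the lemma
      supplies the other two clauses of \<open>?c\<close>.\<close>
    from normal_form_onorm[OF A A0 e d(2-)] d(1) show ?a unfolding ac by blast
  qed
  show ?thesis
    unfolding Let_def
  proof (intro conjI allI impI)
    show "?a \<longleftrightarrow> ?b" using ab bc ca by blast
    show "?a \<longleftrightarrow> (\<exists>\<mu>. ?c \<mu>)" by (rule ac)
    show "?c \<mu> \<longleftrightarrow> ?c' \<mu>" for \<mu> by (rule cc')
    show "?a \<longleftrightarrow> ?d n e" if "orthonormal_basis n e" for n e by (rule ad[OF that])
    show "mat_opnorm (C - (1 / 2) \<cdot>\<^sub>m 1\<^sub>m m) \<le> 1 / 2 \<longleftrightarrow> mat_numerical_range D \<subseteq> {z. Re z \<ge> 1}"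
      if "C \<in> carrier_mat m m \<and> D \<in> carrier_mat m m \<and> inverts_mat C D \<and> inverts_mat D C" for m C D
      using that opnorm_half_iff_numerical_range by blast
  qed
qed

end
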